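(* Let $\psi$ be a conformal map on the unit disk $\mathbb{D}$ with $\psi(0)=0$, and for $\alpha>0$ let $F_\alpha=\{z\in\mathbb{D}:|\psi(z)|=\alpha\}$. Then $$\lim_{\alpha\to+\infty}\frac{d_{\mathbb{D}}(0,F_\alpha)}{\log\alpha}=+\infty\quad\text{if and only if}\quad\lim_{\alpha\to+\infty}\frac{\log\left(\omega_{\mathbb{D}}(0,F_\alpha)^{-1}\right)}{\log\alpha}=+\infty.$$
   Context: A conformal map on $\mathbb{D}=\{z\in\mathbb{C}:|z|<1\}$ is an injective holomorphic function $\psi:\mathbb{D}\to\mathbb{C}$. Hyperbolic distance: for $z,w\in\mathbb{D}$, $d_{\mathbb{D}}(z,w)=\log\frac{1+\left|\frac{z-w}{1-z\bar w}\right|}{1-\left|\frac{z-w}{1-z\bar w}\right|}$; for a set $E\subset\mathbb{D}$, $d_{\mathbb{D}}(z,E)=\inf\{d_{\mathbb{D}}(z,w):w\in E\}$ (with $\inf\emptyset=+\infty$). Harmonic measure: for a domain $D$, $z\in D$ and a Borel set $E\subset\overline{D}$, $\omega_D(z,E)$ denotes the harmonic measure at $z$ of $E$ with respect to the component of $D\setminus E$ containing $z$; i.e. $\omega_D(\cdot,E)$ is the solution of the generalized Dirichlet problem in that component with boundary data $1_E$. If $F_\alpha=\emptyset$, then $\omega_{\mathbb{D}}(0,F_\alpha)=0$ and $\log(\omega_{\mathbb{D}}(0,F_\alpha)^{-1})=+\infty$. *)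

theory Defs
  imports "HOL-Complex_Analysis.Complex_Analysis"
begin

definition hyp_dist :: "complex \<Rightarrow> complex \<Rightarrow> real" where
  "hyp_dist z w =
     ln ((1 + cmod ((z - w) / (1 - z * cnj w))) / (1 - cmod ((z - w) / (1 - z * cnj w))))"

text \<open>Extended-real valued, so that the distance to the empty set is \<open>\<infinity>\<close>.\<close>

definition hyp_setdist :: "complex \<Rightarrow> complex set \<Rightarrow> ereal" where
  "hyp_setdist z E = (INF w\<in>E. ereal (hyp_dist z w))"

definition level_set :: "(complex \<Rightarrow> complex) \<Rightarrow> real \<Rightarrow> complex set" where
  "level_set \<psi> \<alpha> = {z \<in> ball 0 1. cmod (\<psi> z) = \<alpha>}"

text \<open>The mean of \<open>u\<close> over the circle of radius \<open>r\<close> about \<open>z\<close>, as the integral of the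
  positive part minus that of the negative part (\<^const>\<open>e2ennreal\<close> truncates negative values
  to 0). For upper semicontinuous \<open>u < \<infinity>\<close> the positive part is bounded on the circle, so the
  first integral is finite and the difference is never of the form \<open>\<infinity> - \<infinity>\<close>.\<close>

definition circle_mean :: "(complex \<Rightarrow> ereal) \<Rightarrow> complex \<Rightarrow> real \<Rightarrow> ereal" where
  "circle_mean u z r =
     (enn2ereal (\<integral>\<^sup>+t\<in>{0..2 * pi}. e2ennreal (u (z + rcis r t)) \<partial>lborel)
        - enn2ereal (\<integral>\<^sup>+t\<in>{0..2 * pi}. e2ennreal (- u (z + rcis r t)) \<partial>lborel))
     / ereal (2 * pi)"

text \<open>Functions into \<open>[-\<infinity>, \<infinity>)\<close> that are upper semicontinuous and satisfy the local submean
  inequality; \<open>-\<infinity>\<close> identically is admitted.\<close>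

definition subharmonic_on :: "(complex \<Rightarrow> ereal) \<Rightarrow> complex set \<Rightarrow> bool" where
  "subharmonic_on u S \<longleftrightarrow>
     open S \<and>
     (\<forall>z\<in>S. u z < \<infinity> \<and> Limsup (at z within S) u \<le> u z) \<and>
     (\<forall>z\<in>S. \<exists>\<rho>>0. ball z \<rho> \<subseteq> S \<and> (\<forall>r. 0 < r \<and> r < \<rho> \<longrightarrow> u z \<le> circle_mean u z r))"

text \<open>The Perron solution of the generalized Dirichlet problem on the bounded open set \<open>S\<close>
  with boundary data \<open>f\<close> (the boundary is taken in the plane, so boundedness matters).
  It is the upper envelope of the lower Perron class. For bounded Borel \<open>f\<close>, in particular
  for indicators of Borel sets, \<open>f\<close> is resolutive, and this is also the lower envelope of
  the upper class.\<close>

definition perron_solution :: "complex set \<Rightarrow> (complex \<Rightarrow> real) \<Rightarrow> complex \<Rightarrow> ereal" where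
  "perron_solution S f z =
     (SUP u \<in> {u. subharmonic_on u S \<and>
                  (\<forall>\<zeta>\<in>frontier S. Limsup (at \<zeta> within S) u \<le> ereal (f \<zeta>))}. u z)"

text \<open>Harmonic measure at \<open>z\<close> of \<open>E\<close>, with respect to the component of \<open>D - E\<close> that contains
  \<open>z\<close>. Meaningful for a bounded domain \<open>D\<close>, a Borel subset \<open>E\<close> of the closure of \<open>D\<close> such that
  \<open>D - E\<close> is open, and a point \<open>z\<close> of \<open>D - E\<close>.\<close>

definition harmonic_measure :: "complex set \<Rightarrow> complex \<Rightarrow> complex set \<Rightarrow> ereal" where
  "harmonic_measure D z E =
     perron_solution (connected_component_set (D - E) z) (indicator E) z"

text \<open>The logarithm on \<open>[0, \<infinity>]\<close> with \<open>log 0 = -\<infinity>\<close> and \<open>log \<infinity> = \<infinity>\<close>; the library's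
  \<^const>\<open>ln\<close> has \<open>ln 0 = 0\<close>. Together with \<open>inverse 0 = \<infinity>\<close> on \<^typ>\<open>ereal\<close>,
  \<open>log (1 / 0)\<close> is \<open>\<infinity>\<close>.\<close>

definition ereal_log :: "ereal \<Rightarrow> ereal" where
  "ereal_log x =
     (if x \<le> 0 then - \<infinity> else if x = \<infinity> then \<infinity> else ereal (ln (real_of_ereal x)))"

end

theory Submission
  imports Defs
begin

text \<open>Write \<open>F\<close> for the level set, \<open>d\<close> for its distance to \<open>0\<close> and \<open>\<omega>\<close> for its harmonic
  measure. As both limits are infinite, constant factors are harmless.

  Lower bound for \<open>\<omega>\<close>: for \<open>a \<in> F\<close>, the Moebius map of the disc with zero \<open>a\<close> has a
  holomorphic square root \<open>g\<close> on \<open>{|\<psi>| < \<alpha>}\<close>, and the image of \<open>g\<close> misses a disc of radius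
  comparable to \<open>1 - |a|\<close> in the unit disc. This yields an explicit subharmonic competitor and
  \<open>\<omega> \<ge> c (1 - |a|)\<^sup>3\<close>, so \<open>log (1 / \<omega>) \<le> 3 d + C\<close>.

  Upper bound for \<open>\<omega>\<close>: if \<open>d\<close> grows faster than any multiple of \<open>log \<alpha>\<close>, then \<open>|\<psi>(z)|\<close> is
  bounded by every positive power of \<open>1 / (1 - |z|)\<close> up to a constant. Univalence bounds the
  weighted area of the image, hence the Dirichlet integrals of \<open>\<psi>\<^sup>m\<close> over smaller discs,
  so that \<open>\<psi>\<^sup>m\<close> lies in \<open>H\<^sup>2\<close> for all \<open>m\<close>. Since \<open>|\<psi>|\<^sup>2\<^sup>m\<close> equals \<open>\<alpha>\<^sup>2\<^sup>m\<close> on \<open>F\<close>, comparison with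
  its harmonic majorant gives \<open>\<omega> \<le> C \<alpha>\<^sup>-\<^sup>2\<^sup>m\<close>.\<close>

section \<open>Circle means and the maximum principle\<close>

text \<open>Cauchy's integral formula at the centre, parametrised by the angle:
  \<open>du / (u - z)\<close> becomes \<open>\<i> dt\<close>, and the factor \<open>\<i>\<close> is
  removed at the end.\<close>

lemma has_integral_circle_holomorphic:
  fixes f :: "complex \<Rightarrow> complex"
  assumes "f holomorphic_on cball z r" "r > 0"
  shows "((\<lambda>t. f (z + rcis r t)) has_integral (2 * pi * f z)) {0..2 * pi}"
proof -
  have "((\<lambda>u. f u / (u - z)) has_contour_integral (2 * of_real pi * \<i> * f z)) (circlepath z r)"
    using Cauchy_integral_circlepath_simple[OF assms(1), of z] assms(2) by simp
  then have "((\<lambda>t. f (z + r * cis t) / (z + r * cis t - z) * r * \<i> * cis t) has_integral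
      (2 * of_real pi * \<i> * f z)) {0..2 * pi}"
    unfolding circlepath_def by (subst (asm) has_contour_integral_part_circlepath_iff) auto
  then have "((\<lambda>t. \<i> * f (z + rcis r t)) has_integral (2 * of_real pi * \<i> * f z)) {0..2 * pi}"
    using assms(2) by (simp add: rcis_def mult_ac cong: has_integral_cong)
  then have "((\<lambda>t. (- \<i>) * (\<i> * f (z + rcis r t))) has_integral ((- \<i>) * (2 * of_real pi * \<i> * f z))) {0..2 * pi}"
    by (rule has_integral_mult_right)
  then show ?thesis by (simp add: mult_ac)
qed

lemma circle_mean_mono:
  assumes "\<And>t. u (z + rcis r t) \<le> v (z + rcis r t)"
  shows "circle_mean u z r \<le> circle_mean v z r"
proof -
  have "(\<integral>\<^sup>+t\<in>{0..2 * pi}. e2ennreal (u (z + rcis r t)) \<partial>lborel)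
      \<le> (\<integral>\<^sup>+t\<in>{0..2 * pi}. e2ennreal (v (z + rcis r t)) \<partial>lborel)"
    by (intro nn_integral_mono mult_right_mono e2ennreal_mono assms) auto
  moreover have "(\<integral>\<^sup>+t\<in>{0..2 * pi}. e2ennreal (- v (z + rcis r t)) \<partial>lborel)
      \<le> (\<integral>\<^sup>+t\<in>{0..2 * pi}. e2ennreal (- u (z + rcis r t)) \<partial>lborel)"
    by (intro nn_integral_mono mult_right_mono e2ennreal_mono) (auto simp: assms)
  ultimately show ?thesis
    unfolding circle_mean_def
    by (intro ereal_divide_right_mono ereal_minus_mono) (auto simp: less_eq_ennreal.rep_eq)
qed

text \<open>Links \<open>circle_mean\<close> to the gauge integral: on the compact circle the
  positive and negative parts of \<open>k\<close> have finite integrals, so their difference is the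
  ordinary integral.\<close>

lemma circle_mean_continuous:
  fixes k :: "complex \<Rightarrow> real"
  assumes cont: "continuous_on (sphere z r) k"
    and u: "\<And>t. u (z + rcis r t) = ereal (k (z + rcis r t))" and "r > 0"
    and int: "((\<lambda>t. k (z + rcis r t)) has_integral I) {0..2 * pi}"
  shows "circle_mean u z r = ereal (I / (2 * pi))"
proof -
  define g where "g t = k (z + rcis r t)" for t
  have cg: "continuous_on {0..2 * pi} g"
    unfolding g_def rcis_def
    by (rule continuous_on_compose2[OF cont])
      (use \<open>r > 0\<close> in \<open>auto intro!: continuous_intros simp: dist_norm norm_mult\<close>)
  define M where "M = restrict_space lborel {0..2 * pi}"
  have gi: "set_integrable lborel {0..2 * pi} g"
    by (rule borel_integrable_atLeastAtMost') (fact cg)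
  then have "integrable M g"
    unfolding M_def by (subst integrable_restrict_space) (auto simp: set_integrable_def)
  then have eq: "integral\<^sup>L M g = enn2real (\<integral>\<^sup>+x. ennreal (g x) \<partial>M) - enn2real (\<integral>\<^sup>+x. ennreal (- g x) \<partial>M)"
    and fin: "(\<integral>\<^sup>+x. ennreal (g x) \<partial>M) \<noteq> \<infinity>" "(\<integral>\<^sup>+x. ennreal (- g x) \<partial>M) \<noteq> \<infinity>"
    by (auto simp: real_lebesgue_integral_def real_integrable_def)
  have "integral\<^sup>L M g = (LINT t:{0..2 * pi}|lborel. g t)"
    unfolding M_def by (subst integral_restrict_space) (auto simp: set_lebesgue_integral_def)
  also have "\<dots> = I"
    using set_borel_integral_eq_integral(2)[OF gi] integral_unique[OF int]
    unfolding g_def by simp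
  finally have I: "integral\<^sup>L M g = I" .
  have p: "(\<integral>\<^sup>+t\<in>{0..2 * pi}. e2ennreal (u (z + rcis r t)) \<partial>lborel) = (\<integral>\<^sup>+x. ennreal (g x) \<partial>M)"
    unfolding M_def by (subst nn_integral_restrict_space) (auto simp: u g_def e2ennreal_ereal)
  have n: "(\<integral>\<^sup>+t\<in>{0..2 * pi}. e2ennreal (- u (z + rcis r t)) \<partial>lborel) = (\<integral>\<^sup>+x. ennreal (- g x) \<partial>M)"
    unfolding M_def by (subst nn_integral_restrict_space) (auto simp: u g_def e2ennreal_ereal)
  have e: "enn2ereal x = ereal (enn2real x)" if "x \<noteq> \<infinity>" for x
    using that by (cases x) auto
  show ?thesis
    unfolding circle_mean_def p n e[OF fin(1)] e[OF fin(2)]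
    using I eq by simp
qed

lemma circle_mean_Re:
  fixes f :: "complex \<Rightarrow> complex"
  assumes "f holomorphic_on cball z r" "r > 0"
  shows "circle_mean (\<lambda>w. ereal (Re (f w))) z r = ereal (Re (f z))"
proof -
  have "((\<lambda>t. Re (f (z + rcis r t))) has_integral Re (2 * pi * f z)) {0..2 * pi}"
    using has_integral_linear[OF has_integral_circle_holomorphic[OF assms] bounded_linear_Re]
    by (simp add: o_def)
  then have "circle_mean (\<lambda>w. ereal (Re (f w))) z r = ereal (Re (2 * pi * f z) / (2 * pi))"
    using assms by (intro circle_mean_continuous[where k = "\<lambda>w. Re (f w)"])
      (auto intro!: continuous_intros holomorphic_on_imp_continuous_on[OF holomorphic_on_subset[OF assms(1)]] simp: sphere_cball)
  then show ?thesis by simp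
qed

text \<open>The triangle inequality for integrals, applied to the mean value property. The affine
  form in \<open>c\<close> and \<open>d\<close> fits the competitor that bounds harmonic measure
  from below.\<close>

lemma norm_le_circle_mean:
  fixes f :: "complex \<Rightarrow> complex"
  assumes "f holomorphic_on cball z r" "r > 0" and c: "c > 0"
  shows "ereal (c * (norm (f z) - d)) \<le> circle_mean (\<lambda>w. ereal (c * (norm (f w) - d))) z r"
proof -
  have cf: "continuous_on (sphere z r) f"
    by (auto intro!: holomorphic_on_imp_continuous_on[OF holomorphic_on_subset[OF assms(1)]])
  have ct: "continuous_on {0..2 * pi} (\<lambda>t. f (z + rcis r t))"
    unfolding rcis_def
    by (rule continuous_on_compose2[OF cf])
      (use \<open>r > 0\<close> in \<open>auto intro!: continuous_intros simp: dist_norm norm_mult\<close>)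
  have i: "(\<lambda>t. norm (f (z + rcis r t))) integrable_on {0..2 * pi}"
    by (intro integrable_continuous_interval continuous_intros ct)
  have "norm (2 * pi * f z) \<le> integral {0..2*pi} (\<lambda>t. norm (f (z + rcis r t)))"
    using integral_norm_bound_integral[OF _ i] has_integral_circle_holomorphic[OF assms(1,2)]
    by (metis (mono_tags, lifting) has_integral_integrable integral_unique order_refl)
  then have le: "2 * pi * norm (f z) \<le> integral {0..2*pi} (\<lambda>t. norm (f (z + rcis r t)))"
    by (simp add: norm_mult)
  have "((\<lambda>t. c * (norm (f (z + rcis r t)) - d)) has_integral
      c * (integral {0..2*pi} (\<lambda>t. norm (f (z + rcis r t))) - (2 * pi - 0) *\<^sub>R d)) {0..2 * pi}"
    by (intro has_integral_mult_right has_integral_diff integrable_integral i has_integral_const_real[THEN has_integral_eq_rhs]) simp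
  then have "circle_mean (\<lambda>w. ereal (c * (norm (f w) - d))) z r
     = ereal ((c * (integral {0..2*pi} (\<lambda>t. norm (f (z + rcis r t))) - 2 * pi * d)) / (2 * pi))"
    by (intro circle_mean_continuous[where k = "\<lambda>w. c * (norm (f w) - d)"] assms)
      (auto intro!: continuous_intros cf)
  also have "\<dots> \<ge> ereal (c * (norm (f z) - d))"
    using le c by (simp add: field_simps)
  finally show ?thesis .
qed

text \<open>The cross term is the real part of a function holomorphic in \<open>y\<close>; it can
  therefore be absorbed into harmonic majorants, and its circle means are known.\<close>

lemma cmod_add_squared: "(cmod (x + y))\<^sup>2 = (cmod x)\<^sup>2 + 2 * Re (cnj x * y) + (cmod y)\<^sup>2"
  by (simp only: cmod_power2 plus_complex.simps times_complex.simps complex_cnj cnj.simps) algebra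

text \<open>The filter \<open>at x\<close> ignores \<open>x\<close> itself, hence the exclusion of
  \<open>x\<close> in the conclusion.\<close>

lemma Limsup_le_eventually_less:
  fixes u :: "'a :: topological_space \<Rightarrow> ereal"
  assumes "Limsup (at x within S) u \<le> l" "l < c"
  shows "\<exists>N. open N \<and> x \<in> N \<and> (\<forall>y\<in>N \<inter> S - {x}. u y < c)"
proof -
  have "\<forall>\<^sub>F y in at x within S. u y < c"
    using assms by (intro Limsup_lessD) auto
  then show ?thesis
    unfolding eventually_at_topological by auto
qed

text \<open>A violating point would make \<open>u - Re h + \<eta> |z|\<^sup>2\<close> attain an interior maximum for small
  \<open>\<eta> > 0\<close>, and there the circle means of the strictly superharmonic \<open>Re h - \<eta> |z|\<^sup>2\<close> are too small.\<close>

lemma subharmonic_le_Re_holomorphic: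
  assumes u: "subharmonic_on u S" and bS: "bounded S" and h: "h holomorphic_on UNIV"
    and bd: "\<And>\<zeta>. \<zeta> \<in> frontier S \<Longrightarrow> Limsup (at \<zeta> within S) u \<le> ereal (Re (h \<zeta>))"
    and z: "z \<in> S"
  shows "u z \<le> ereal (Re (h z))"
proof (rule ccontr)
  assume neg: "\<not> ?thesis"
  have oS: "open S" and ltinf: "\<And>z. z \<in> S \<Longrightarrow> u z < \<infinity>"
    and usc: "\<And>z. z \<in> S \<Longrightarrow> Limsup (at z within S) u \<le> u z"
    and sub: "\<And>z. z \<in> S \<Longrightarrow> \<exists>\<rho>>0. ball z \<rho> \<subseteq> S \<and> (\<forall>r. 0 < r \<and> r < \<rho> \<longrightarrow> u z \<le> circle_mean u z r)"
    using u unfolding subharmonic_on_def by auto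
  obtain R where R: "R > 0" "\<And>w. w \<in> closure S \<Longrightarrow> norm w \<le> R"
    using bS by (metis bounded_closure bounded_pos)
  obtain uz where uz: "u z = ereal uz" "Re (h z) < uz"
    using neg ltinf[OF z] by (cases "u z") auto
  \<comment> \<open>With this choice \<open>\<eta> * R^2\<close> is half of the violation at
    \<open>z\<close>. Adding \<open>\<eta> |x|^2\<close> to \<open>u - Re h\<close> therefore leaves
    the boundary values below the value at \<open>z\<close>.\<close>
  define \<eta> where "\<eta> = (uz - Re (h z)) / (2 * R\<^sup>2)"
  have \<eta>: "\<eta> > 0" using uz R by (simp add: \<eta>_def)
  define q where "q w = Re (h w) - \<eta> * (norm w)\<^sup>2" for w
  define w where "w x = u x - ereal (q x)" for x
  define W where "W = (SUP x\<in>S. w x)"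
  have ch: "continuous_on UNIV h" using h by (rule holomorphic_on_imp_continuous_on)
  have cq: "continuous_on UNIV q" unfolding q_def by (intro continuous_intros ch)
  have "uz - q z \<ge> uz - Re (h z)" using \<eta> by (simp add: q_def)
  also have "uz - Re (h z) = 2 * (\<eta> * R\<^sup>2)" using R by (simp add: \<eta>_def)
  finally have "\<eta> * R\<^sup>2 < uz - q z" using mult_pos_pos[OF \<eta> zero_less_power[OF R(1), of 2]] by linarith
  moreover have "w z \<le> W" unfolding W_def by (rule SUP_upper) fact
  ultimately have Wbig: "ereal (\<eta> * R\<^sup>2) < W" "-\<infinity> < W"
    by (auto simp: w_def uz intro: less_le_trans[of _ "w z"])
  \<comment> \<open>The gap \<open>c1 - c2\<close> is spent on the variation of the continuous
    \<open>q\<close> near \<open>x\<close>. Real bounds are interposed because \<open>l\<close> may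
    be \<open>-\<infinity>\<close>.\<close>
  have local: "\<exists>N. open N \<and> x \<in> N \<and> (\<forall>y\<in>N \<inter> S - {x}. w y < c)"
    if l1: "Limsup (at x within S) u \<le> l" and l2: "l - ereal (q x) < c" for x l c
  proof -
    have "l < \<infinity>" using l2 by (cases l; cases c) auto
    obtain c1 where c1: "l - ereal (q x) < ereal c1" "ereal c1 < c"
      using ereal_dense2[OF l2] by auto
    obtain c2 where c2: "l - ereal (q x) < ereal c2" "c2 < c1"
      using ereal_dense2[OF c1(1)] by auto
    have "l < ereal (c2 + q x)" using c2 by (cases l) auto
    from Limsup_le_eventually_less[OF l1 this]
    obtain N where N: "open N" "x \<in> N" "\<And>y. y \<in> N \<inter> S - {x} \<Longrightarrow> u y < ereal (c2 + q x)" by blast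
    let ?N = "N \<inter> {y. q x - (c1 - c2) < q y}"
    have "open {y. q x - (c1 - c2) < q y}"
      using open_Collect_less[OF continuous_on_const cq] by simp
    moreover have "w y < c" if "y \<in> ?N \<inter> S - {x}" for y
    proof -
      have "u y < ereal (c2 + q x)" "q x - (c1 - c2) < q y" using N(3) that by auto
      then have "w y < ereal c1" unfolding w_def by (cases "u y") auto
      then show ?thesis using c1 by simp
    qed
    ultimately show ?thesis using N c2 by (intro exI[of _ ?N]) auto
  qed
  \<comment> \<open>If the supremum were not attained, every point of the compact closure would have
    a neighbourhood on which \<open>w\<close> stays below some constant less than \<open>W\<close>;
    a finite subcover then contradicts the definition of \<open>W\<close>.\<close>
  have "\<exists>x\<in>S. w x = W"
  proof (rule ccontr)
    assume no: "\<not> (\<exists>x\<in>S. w x = W)"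
    have lt: "w x < W" if "x \<in> S" for x
      using no that SUP_upper[of x S w] by (auto simp: W_def[symmetric] less_le)
    have "\<exists>N c. open N \<and> x \<in> N \<and> c < W \<and> (\<forall>y\<in>N \<inter> S. w y \<le> c)" if x: "x \<in> closure S" for x
    proof (cases "x \<in> S")
      case True
      obtain c where c: "w x < c" "c < W" using dense[OF lt[OF True]] by auto
      from local[OF usc[OF True] c(1)[unfolded w_def]]
      obtain N where "open N" "x \<in> N" "\<And>y. y \<in> N \<inter> S - {x} \<Longrightarrow> w y < c" by blast
      with c show ?thesis by (intro exI[of _ N] exI[of _ c]) (auto intro: less_imp_le)
    next
      case False
      then have f: "x \<in> frontier S" using x oS by (simp add: frontier_def interior_open)
      obtain c where c: "ereal (\<eta> * R\<^sup>2) < c" "c < W" using dense[OF Wbig(1)] by auto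
      have "Re (h x) - q x \<le> \<eta> * R\<^sup>2"
        using R(2)[OF x] \<eta> R(1) by (simp add: q_def)
      then have "ereal (Re (h x)) - ereal (q x) < c"
        using c(1) by (auto intro: le_less_trans[rotated])
      from local[OF bd[OF f] this]
      obtain N where "open N" "x \<in> N" "\<And>y. y \<in> N \<inter> S - {x} \<Longrightarrow> w y < c" by blast
      with c False show ?thesis by (intro exI[of _ N] exI[of _ c]) (auto intro: less_imp_le)
    qed
    then obtain N c where Nc: "\<And>x. x \<in> closure S \<Longrightarrow>
        open (N x) \<and> x \<in> N x \<and> c x < W \<and> (\<forall>y\<in>N x \<inter> S. w y \<le> c x)"
      by metis
    have "compact (closure S)" using bS by (simp add: compact_closure)
    moreover have "closure S \<subseteq> (\<Union>x\<in>closure S. N x)" using Nc by blast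
    ultimately obtain X where X: "X \<subseteq> closure S" "finite X" "closure S \<subseteq> (\<Union>x\<in>X. N x)"
      using compactE_image[of "closure S" "closure S" N] Nc by metis
    have zX: "X \<noteq> {}" using X z closure_subset by fastforce
    have "W \<le> Max (c ` X)" unfolding W_def
    proof (rule SUP_least)
      fix y assume y: "y \<in> S"
      then obtain x where x: "x \<in> X" "y \<in> N x" using X closure_subset by blast
      then have "w y \<le> c x" using Nc[of x] X y by auto
      also have "c x \<le> Max (c ` X)" using x X by simp
      finally show "w y \<le> Max (c ` X)" .
    qed
    moreover have "Max (c ` X) < W" using X zX Nc by (subst Max_less_iff) auto
    ultimately show False by simp
  qed
  then obtain x where x: "x \<in> S" "w x = W" by auto
  have "w y \<le> w x" if "y \<in> S" for y
    unfolding x(2) W_def using that by (rule SUP_upper)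
  moreover obtain a where a: "u x = ereal a"
    using Wbig(2) ltinf[OF x(1)] x(2) by (cases "u x") (auto simp: w_def)
  ultimately have le: "u y \<le> ereal (a + q y - q x)" if "y \<in> S" for y
    using that[THEN \<open>\<And>y. y \<in> S \<Longrightarrow> w y \<le> w x\<close>] by (cases "u y") (auto simp: w_def a)
  obtain \<rho> where \<rho>: "\<rho> > 0" "ball x \<rho> \<subseteq> S" "\<And>r. 0 < r \<Longrightarrow> r < \<rho> \<Longrightarrow> u x \<le> circle_mean u x r"
    using sub[OF x(1)] by auto
  define r where "r = \<rho> / 2"
  have r: "r > 0" "r < \<rho>" using \<rho> by (auto simp: r_def)
  \<comment> \<open>On the circle of radius \<open>r\<close> about \<open>x\<close>,
    \<open>|y|^2 = |x|^2 + r^2 + 2 Re (cnj x * (y - x))\<close>. So \<open>Re K\<close> is harmonic,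
    agrees there with \<open>a + q y - q x\<close>, and has the value
    \<open>a - \<eta> * r^2\<close> at the centre.\<close>
  define K where "K y = of_real a + h y - h x - of_real \<eta> * (of_real (r\<^sup>2) + 2 * cnj x * (y - x))" for y
  have "u (x + rcis r t) \<le> ereal (Re (K (x + rcis r t)))" for t
  proof -
    have "x + rcis r t \<in> S"
      using \<rho>(2) r by (auto simp: dist_norm norm_mult subset_eq)
    from le[OF this] show ?thesis
    proof (rule order_trans)
      have "(norm (x + rcis r t))\<^sup>2 = (norm x)\<^sup>2 + r\<^sup>2 + 2 * Re (cnj x * rcis r t)"
        by (simp add: cmod_add_squared)
      then show "ereal (a + q (x + rcis r t) - q x) \<le> ereal (Re (K (x + rcis r t)))"
        by (simp add: q_def K_def algebra_simps)
    qed
  qed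
  then have "circle_mean u x r \<le> circle_mean (\<lambda>y. ereal (Re (K y))) x r"
    by (rule circle_mean_mono)
  also have "\<dots> = ereal (Re (K x))"
    unfolding K_def
    by (intro circle_mean_Re r holomorphic_intros holomorphic_on_subset[OF h]) auto
  also have "\<dots> = ereal (a - \<eta> * r\<^sup>2)" by (simp add: K_def)
  finally have "u x \<le> ereal (a - \<eta> * r\<^sup>2)" using \<rho>(3)[OF r] by (rule order_trans[rotated])
  then show False using a \<eta> r by (simp add: mult_le_0_iff)
qed

lemma subharmonic_on_subset:
  assumes "subharmonic_on u S" "open T" "T \<subseteq> S"
  shows "subharmonic_on u T"
  unfolding subharmonic_on_def
proof (intro conjI ballI)
  fix z assume z: "z \<in> T"
  then have zS: "z \<in> S" using assms by auto
  show "u z < \<infinity>" using assms zS by (auto simp: subharmonic_on_def)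
  have "open S" "Limsup (at z within S) u \<le> u z" using assms zS by (auto simp: subharmonic_on_def)
  then show "Limsup (at z within T) u \<le> u z"
    using at_within_open[OF zS] at_within_open[OF z] assms by simp
  obtain \<rho> where \<rho>: "\<rho> > 0" "\<And>r. 0 < r \<Longrightarrow> r < \<rho> \<Longrightarrow> u z \<le> circle_mean u z r"
    using assms zS by (auto simp: subharmonic_on_def)
  obtain \<rho>' where \<rho>': "\<rho>' > 0" "ball z \<rho>' \<subseteq> T"
    using assms(2) z by (meson openE)
  show "\<exists>\<rho>>0. ball z \<rho> \<subseteq> T \<and> (\<forall>r. 0 < r \<and> r < \<rho> \<longrightarrow> u z \<le> circle_mean u z r)"
    using \<rho> \<rho>' by (intro exI[of _ "min \<rho> \<rho>'"]) auto
qed (use assms in auto)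

text \<open>Horner induction: for \<open>p = a 0 + z * q\<close> the cross term of
  \<open>|p|^2\<close> is already harmonic, and \<open>|z q|^2 \<le> |q|^2\<close> in the disc. At 0
  the majorant equals the squared \<open>H^2\<close> norm of the polynomial.\<close>

lemma polynomial_norm_majorant:
  "\<exists>G. G holomorphic_on UNIV \<and> G 0 = of_real (\<Sum>n<N. (norm (a n))\<^sup>2) \<and>
     (\<forall>z. norm z \<le> 1 \<longrightarrow> (norm (\<Sum>n<N. a n * z ^ n))\<^sup>2 \<le> Re (G z))"
proof (induction N arbitrary: a)
  case 0
  show ?case by (rule exI[of _ "\<lambda>_. 0"]) auto
next
  case (Suc N)
  from Suc.IH[of "\<lambda>n. a (Suc n)"] obtain G where
    G: "G holomorphic_on UNIV" "G 0 = of_real (\<Sum>n<N. (norm (a (Suc n)))\<^sup>2)"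
      "\<And>z. norm z \<le> 1 \<Longrightarrow> (norm (\<Sum>n<N. a (Suc n) * z ^ n))\<^sup>2 \<le> Re (G z)" by blast
  define q where "q z = (\<Sum>n<N. a (Suc n) * z ^ n)" for z
  define H where "H z = of_real ((norm (a 0))\<^sup>2) + 2 * cnj (a 0) * z * q z + G z" for z
  have "H holomorphic_on UNIV"
    unfolding H_def q_def by (intro holomorphic_intros G)
  moreover have "H 0 = of_real (\<Sum>n<Suc N. (norm (a n))\<^sup>2)"
    by (simp add: H_def G(2) sum.lessThan_Suc_shift del: sum.lessThan_Suc)
  moreover have "(norm (\<Sum>n<Suc N. a n * z ^ n))\<^sup>2 \<le> Re (H z)" if z: "norm z \<le> 1" for z
  proof -
    have "(\<Sum>n<Suc N. a n * z ^ n) = a 0 + z * q z"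
      by (simp add: q_def sum.lessThan_Suc_shift sum_distrib_left mult_ac del: sum.lessThan_Suc)
    moreover have "(norm (a 0 + z * q z))\<^sup>2 = (norm (a 0))\<^sup>2 + 2 * Re (cnj (a 0) * (z * q z)) + (norm (z * q z))\<^sup>2"
      by (simp add: cmod_add_squared)
    moreover have "(norm (z * q z))\<^sup>2 \<le> Re (G z)"
    proof -
      have "(norm (z * q z))\<^sup>2 \<le> (norm (q z))\<^sup>2"
        using z by (intro power_mono) (auto simp: norm_mult mult_left_le_one_le)
      then show ?thesis using G(3)[OF z, folded q_def] by linarith
    qed
    moreover have "Re (H z) = (norm (a 0))\<^sup>2 + 2 * Re (cnj (a 0) * (z * q z)) + Re (G z)"
      by (simp add: H_def mult.assoc)
    ultimately show ?thesis by simp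
  qed
  ultimately show ?case by blast
qed

section \<open>Harmonic measure and the Hardy space $H^2$\<close>

lemma component_disc_minus:
  assumes "open (ball 0 1 - E)" "(0::complex) \<notin> E"
  defines "S \<equiv> connected_component_set (ball 0 1 - E) 0"
  shows "open S" "0 \<in> S" "S \<subseteq> ball 0 1 - E" "frontier S \<subseteq> E \<union> sphere 0 1" "connected S"
proof -
  show "open S" unfolding S_def using assms(1) by (rule open_connected_component)
  show "0 \<in> S" "S \<subseteq> ball 0 1 - E" "connected S"
    unfolding S_def using assms(2) connected_component_subset by (auto simp: connected_component_refl)
  have "frontier S \<subseteq> frontier (ball 0 1 - E)"
    unfolding S_def by (rule frontier_of_connected_component_subset)
  also have "\<dots> \<subseteq> cball 0 1 - (ball 0 1 - E)"
    using assms(1) closure_mono[of "ball 0 1 - E" "ball 0 1"]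
    by (auto simp: frontier_def interior_open)
  also have "\<dots> \<subseteq> E \<union> sphere 0 1" by auto
  finally show "frontier S \<subseteq> E \<union> sphere 0 1" .
qed

text \<open>A competitor \<open>u\<close> in the lower Perron class is uniformly small near the unit circle, since
  the indicator of \<open>E\<close> vanishes there. So it suffices to compare \<open>u\<close> with the majorant
  of a Taylor polynomial of \<open>f\<close> on a smaller disc.\<close>

lemma harmonic_measure_le_H2:
  assumes E: "E \<subseteq> ball 0 1" "open (ball 0 1 - E)" "0 \<notin> E"
    and f: "\<And>z. z \<in> ball 0 1 \<Longrightarrow> (\<lambda>n. a n * z ^ n) sums f z"
    and A: "\<And>N. (\<Sum>n<N. (norm (a n))\<^sup>2) \<le> A"
    and c: "c > 0" "\<And>z. z \<in> E \<Longrightarrow> c \<le> norm (f z)"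
  shows "harmonic_measure (ball 0 1) 0 E \<le> ereal (4 * A / c\<^sup>2)"
proof -
  define S where "S = connected_component_set (ball 0 1 - E) 0"
  note S = component_disc_minus[OF E(2,3), folded S_def]
  have "u 0 \<le> ereal (4 * A / c\<^sup>2)"
    if u: "subharmonic_on u S" and bd: "\<And>\<zeta>. \<zeta> \<in> frontier S \<Longrightarrow> Limsup (at \<zeta> within S) u \<le> ereal (indicator E \<zeta>)" for u
  proof (rule ereal_le_epsilon2)
    fix \<epsilon> :: real assume \<epsilon>: "\<epsilon> > 0"
    have "\<exists>N. open N \<and> \<zeta> \<in> N \<and> (\<forall>z\<in>N \<inter> S. u z < ereal \<epsilon>)" if \<zeta>: "\<zeta> \<in> sphere 0 1" for \<zeta>
    proof (cases "\<zeta> \<in> closure S")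
      case False
      then show ?thesis
        using closure_subset[of S] by (intro exI[of _ "- closure S"]) auto
    next
      case True
      have "\<zeta> \<notin> S" "\<zeta> \<notin> E" using S(3) E(1) \<zeta> by auto
      then have "\<zeta> \<in> frontier S" using True S(1) by (simp add: frontier_def interior_open)
      from bd[OF this] have "Limsup (at \<zeta> within S) u \<le> 0"
        using \<open>\<zeta> \<notin> E\<close> by (simp add: zero_ereal_def)
      from Limsup_le_eventually_less[OF this, of "ereal \<epsilon>"] \<epsilon> \<open>\<zeta> \<notin> S\<close> show ?thesis by auto
    qed
    then obtain N where N: "\<And>\<zeta>. \<zeta> \<in> sphere 0 1 \<Longrightarrow> open (N \<zeta>) \<and> \<zeta> \<in> N \<zeta> \<and> (\<forall>z\<in>N \<zeta> \<inter> S. u z < ereal \<epsilon>)"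
      by metis
    \<comment> \<open>The part of the closed disc not covered by the neighbourhoods is compact and
      avoids the unit circle, so it lies in a disc of radius \<open>r0 < 1\<close>; outside that
      disc \<open>u < \<epsilon>\<close>.\<close>
    define K where "K = cball (0::complex) 1 - (\<Union>\<zeta>\<in>sphere 0 1. N \<zeta>)"
    have "compact K" unfolding K_def using N by (intro compact_diff) auto
    have K1: "K \<subseteq> ball 0 1" unfolding K_def using N by (auto simp: less_le)
    have "\<exists>r. 0 < r \<and> r < 1 \<and> K \<subseteq> cball 0 r"
    proof (cases "K = {}")
      case True then show ?thesis by (intro exI[of _ "1/2"]) auto
    next
      case False
      from continuous_attains_sup[OF \<open>compact K\<close> False, of norm]
      obtain x where "x \<in> K" "\<And>y. y \<in> K \<Longrightarrow> norm y \<le> norm x" by (auto intro: continuous_intros)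
      then show ?thesis using K1
        by (intro exI[of _ "max (norm x) (1/2)"]) (auto simp: le_max_iff_disj)
    qed
    then obtain r0 where r0: "0 < r0" "r0 < 1" "K \<subseteq> cball 0 r0" by auto
    have small: "u z < ereal \<epsilon>" if "z \<in> S" "r0 < norm z" for z
    proof -
      have "z \<notin> K" "z \<in> cball 0 1" using that r0 S(3) by auto
      then obtain \<zeta> where "\<zeta> \<in> sphere 0 1" "z \<in> N \<zeta>" by (auto simp: K_def)
      then show ?thesis using N[of \<zeta>] that by auto
    qed
    define r where "r = (r0 + 1) / 2"
    have r: "0 < r" "r < 1" "r0 < r" using r0 by (auto simp: r_def)
    \<comment> \<open>Convergence at a point of modulus \<open>t > r\<close> makes the Taylor
      polynomials converge uniformly on \<open>cball 0 r\<close>. The error \<open>c / 2\<close>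
      leaves them at least \<open>c / 2\<close> in modulus on \<open>E\<close>, which produces the
      factor \<open>4 / c^2\<close>.\<close>
    define t where "t = (r + 1) / 2"
    have t: "0 < t" "t < 1" "r < t" using r by (auto simp: t_def)
    have "summable (\<lambda>n. a n * of_real t ^ n)" using f[of "of_real t"] t by (auto dest: sums_summable)
    then have "ereal (norm (of_real t :: complex)) \<le> conv_radius a" by (rule conv_radius_geI)
    then have "ereal r < conv_radius a" using t by (auto intro: less_le_trans[rotated])
    then have "uniform_limit (cball 0 r) (\<lambda>n x. \<Sum>i<n. a i * (x - 0) ^ i) (\<lambda>x. suminf (\<lambda>i. a i * (x - 0) ^ i)) sequentially"
      by (rule powser_uniform_limit)
    then have "\<forall>\<^sub>F n in sequentially. \<forall>x\<in>cball 0 r. dist (\<Sum>i<n. a i * (x - 0) ^ i) (suminf (\<lambda>i. a i * (x - 0) ^ i)) < c / 2"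
      by (rule uniform_limitD) (use c in auto)
    from eventually_happens'[OF sequentially_bot this]
    obtain M where M: "\<And>x. x \<in> cball 0 r \<Longrightarrow> dist (\<Sum>i<M. a i * x ^ i) (suminf (\<lambda>i. a i * x ^ i)) < c / 2"
      unfolding diff_zero by blast
    obtain G where G: "G holomorphic_on UNIV" "G 0 = of_real (\<Sum>n<M. (norm (a n))\<^sup>2)"
      "\<And>z. norm z \<le> 1 \<Longrightarrow> (norm (\<Sum>n<M. a n * z ^ n))\<^sup>2 \<le> Re (G z)"
      using polynomial_norm_majorant[of a M] by blast
    \<comment> \<open>The summand \<open>\<epsilon>\<close> dominates \<open>u\<close> on the circle
      \<open>|z| = r\<close>; the multiple of \<open>G\<close> dominates the boundary value 1 on
      \<open>E\<close>.\<close>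
    define h where "h z = of_real \<epsilon> + of_real (4 / c\<^sup>2) * G z" for z
    have Reh: "Re (h z) = \<epsilon> + 4 / c\<^sup>2 * Re (G z)" for z
      by (simp add: h_def del: of_real_divide)
    have hpos: "\<epsilon> \<le> Re (h z)" if "norm z \<le> 1" for z
      using order_trans[OF zero_le_power2 G(3)[OF that]] by (simp add: Reh)
    have hbig: "1 \<le> Re (h z)" if z: "z \<in> E" "norm z \<le> r" for z
    proof -
      have "z \<in> ball 0 1" using z E by auto
      have "dist (\<Sum>i<M. a i * z ^ i) (f z) < c / 2"
        using M[of z] sums_unique[OF f[OF \<open>z \<in> ball 0 1\<close>]] z by simp
      moreover have "c \<le> norm (f z)" using c z by auto
      ultimately have "c / 2 \<le> norm (\<Sum>i<M. a i * z ^ i)"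
        using norm_triangle_ineq2[of "f z" "\<Sum>i<M. a i * z ^ i"] by (simp add: dist_norm norm_minus_commute)
      then have "(c / 2)\<^sup>2 \<le> (norm (\<Sum>i<M. a i * z ^ i))\<^sup>2" using c by (intro power_mono) auto
      also have "\<dots> \<le> Re (G z)" using z r by (intro G) auto
      finally have "4 / c\<^sup>2 * (c / 2)\<^sup>2 \<le> 4 / c\<^sup>2 * Re (G z)" using c by (intro mult_left_mono) auto
      moreover have "4 / c\<^sup>2 * (c / 2)\<^sup>2 = 1" using c by (simp add: power_divide)
      ultimately show ?thesis using \<epsilon> unfolding Reh by linarith
    qed
    define S' where "S' = S \<inter> ball 0 r"
    have "u 0 \<le> ereal (Re (h 0))"
    proof (rule subharmonic_le_Re_holomorphic[of u S'])
      show "subharmonic_on u S'"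
        by (rule subharmonic_on_subset[OF u]) (auto simp: S'_def S(1))
      show "bounded S'" by (auto simp: S'_def intro: bounded_subset[of "ball 0 r"])
      show "h holomorphic_on UNIV" unfolding h_def by (intro holomorphic_intros G)
      show "0 \<in> S'" using S(2) r by (simp add: S'_def)
      fix \<zeta> assume \<zeta>: "\<zeta> \<in> frontier S'"
      have "open S'" using S(1) by (auto simp: S'_def)
      then have \<zeta>S: "\<zeta> \<in> closure S'" "\<zeta> \<notin> S'" using \<zeta> by (auto simp: frontier_def interior_open)
      have "closure S' \<subseteq> closure S" "closure S' \<subseteq> cball 0 r"
        using closure_mono[of S' S] closure_mono[of S' "ball 0 r"] r by (auto simp: S'_def)
      then have cl: "\<zeta> \<in> closure S" "norm \<zeta> \<le> r" using \<zeta>S by auto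
      show "Limsup (at \<zeta> within S') u \<le> ereal (Re (h \<zeta>))"
      proof (cases "norm \<zeta> = r")
        case True
        have "\<forall>\<^sub>F z in at \<zeta> within S'. z \<in> S' \<and> r0 < norm z"
        proof (intro eventually_conj)
          have "((\<lambda>z. norm z) \<longlongrightarrow> norm \<zeta>) (at \<zeta> within S')" by (intro tendsto_intros)
          then show "\<forall>\<^sub>F z in at \<zeta> within S'. r0 < norm z"
            using order_tendstoD(1)[of norm "norm \<zeta>" "at \<zeta> within S'" r0] True r by simp
          show "\<forall>\<^sub>F z in at \<zeta> within S'. z \<in> S'" by (auto simp: eventually_at_filter)
        qed
        then have "\<forall>\<^sub>F z in at \<zeta> within S'. u z \<le> ereal \<epsilon>"
          by eventually_elim (use small in \<open>auto simp: S'_def intro: less_imp_le\<close>)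
        then have "Limsup (at \<zeta> within S') u \<le> ereal \<epsilon>" by (rule Limsup_bounded)
        also have "\<dots> \<le> ereal (Re (h \<zeta>))" using hpos[of \<zeta>] cl r by simp
        finally show ?thesis .
      next
        case False
        then have "\<zeta> \<in> ball 0 r" using cl by auto
        then have "\<zeta> \<notin> S" using \<zeta>S by (auto simp: S'_def)
        then have fr: "\<zeta> \<in> frontier S" using cl S(1) by (simp add: frontier_def interior_open)
        then have "\<zeta> \<in> E" using S(4) cl r by auto
        have "Limsup (at \<zeta> within S') u \<le> Limsup (at \<zeta> within S) u"
          unfolding Limsup_def
          by (rule INF_superset_mono) (auto simp: S'_def elim: filter_leD[OF at_le, rotated])
        also have "\<dots> \<le> ereal (indicator E \<zeta>)" by (rule bd[OF fr])
        also have "\<dots> \<le> ereal (Re (h \<zeta>))" using hbig[OF \<open>\<zeta> \<in> E\<close> cl(2)] \<open>\<zeta> \<in> E\<close> by simp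
        finally show ?thesis .
      qed
    qed
    also have "Re (h 0) \<le> 4 * A / c\<^sup>2 + \<epsilon>"
      using mult_left_mono[OF A[of M], of "4 / c\<^sup>2"] c by (simp add: Reh G(2))
    finally show "u 0 \<le> ereal (4 * A / c\<^sup>2) + ereal \<epsilon>" by simp
  qed
  then show ?thesis
    unfolding harmonic_measure_def perron_solution_def S_def[symmetric]
    by (intro SUP_least) auto
qed

section \<open>A lower bound for the harmonic measure of a level set\<close>

text \<open>Compares denominator and numerator of a Moebius map of the disc: for
  \<open>|b| < 1\<close> the difference is positive when \<open>|g| < 1\<close> and zero when
  \<open>|g| = 1\<close>. It serves both the map with zero \<open>a\<close> and the reciprocal map
  with pole \<open>b\<close>.\<close>

lemma disc_moebius_identity:
  "(cmod (1 - cnj b * g))\<^sup>2 - (cmod (g - b))\<^sup>2 = (1 - (cmod b)\<^sup>2) * (1 - (cmod g)\<^sup>2)"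
  by (simp only: cmod_power2 minus_complex.simps times_complex.simps complex_cnj cnj.simps one_complex.simps) algebra

lemma disc_moebius_inj:
  assumes "cmod a < 1" "cmod z < 1" "cmod w < 1"
    and eq: "(z - a) / (1 - cnj a * z) = (w - a) / (1 - cnj a * w)"
  shows "z = w"
proof -
  have nz: "1 - cnj a * x \<noteq> 0" if "cmod x < 1" for x
  proof -
    have "cmod (cnj a * x) < 1 * 1" using assms(1) that unfolding norm_mult
      by (intro mult_strict_mono') auto
    then show ?thesis by auto
  qed
  have "(z - a) * (1 - cnj a * w) = (w - a) * (1 - cnj a * z)"
    using eq nz[OF assms(2)] nz[OF assms(3)] by (simp add: field_simps)
  then have "(z - w) * (1 - a * cnj a) = 0" by algebra
  moreover have "1 - a * cnj a \<noteq> 0"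
    using nz[OF assms(1)] by (simp add: mult.commute)
  ultimately show ?thesis by simp
qed

text \<open>The factor \<open>1 - \<psi> / \<psi>(a)\<close> has positive real part where \<open>|\<psi>| < |\<psi>(a)|\<close>, and the
  quotient of the Moebius map by it has no zeros in the disc, so both have square roots.\<close>

lemma moebius_sqrt_on_sublevel:
  assumes hol: "\<psi> holomorphic_on ball 0 1" and inj: "inj_on \<psi> (ball 0 1)"
    and a: "cmod a < 1" "\<psi> a \<noteq> 0"
  obtains g where "g holomorphic_on {z \<in> ball 0 1. cmod (\<psi> z) < cmod (\<psi> a)}"
    "\<And>z. z \<in> ball 0 1 \<Longrightarrow> (g z)\<^sup>2 = (z - a) / (1 - cnj a * z)"
proof -
  have aD: "a \<in> ball 0 1" using a by simp
  \<comment> \<open>The difference quotient of \<psi> at \<open>a\<close>, with its removable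
    singularity filled in. Injectivity makes it zero-free, also at \<open>a\<close>, where the
    derivative is nonzero.\<close>
  define P where "P z = (if z = a then deriv \<psi> a else (\<psi> z - \<psi> a) / (z - a))" for z
  have P: "P holomorphic_on ball 0 1"
    unfolding P_def by (rule pole_lemma_open[OF hol]) auto
  have "deriv \<psi> a \<noteq> 0"
    using holomorphic_injective_imp_regular[OF hol open_ball inj aD] .
  then have P0: "P z \<noteq> 0" if "z \<in> ball 0 1" for z
    using that inj aD by (auto simp: P_def inj_on_def)
  have nz: "1 - cnj a * z \<noteq> 0" if "z \<in> ball 0 1" for z
  proof -
    have "cmod (cnj a * z) < 1 * 1" using a that unfolding norm_mult
      by (intro mult_strict_mono') auto
    then show ?thesis by auto
  qed
  define Q where "Q z = - \<psi> a / ((1 - cnj a * z) * P z)" for z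
  have "Q holomorphic_on ball 0 1"
    unfolding Q_def by (intro holomorphic_intros P) (use nz P0 in auto)
  moreover have "Q z \<noteq> 0" if "z \<in> ball 0 1" for z using nz[OF that] P0[OF that] a by (simp add: Q_def)
  ultimately obtain k where k: "k holomorphic_on ball 0 1" "\<And>z. z \<in> ball 0 1 \<Longrightarrow> Q z = (k z)\<^sup>2"
    using contractible_imp_holomorphic_sqrt[of Q "ball 0 1"] convex_imp_contractible by (metis convex_ball)
  define g where "g z = k z * csqrt (1 - \<psi> z / \<psi> a)" for z
  have "g holomorphic_on {z \<in> ball 0 1. cmod (\<psi> z) < cmod (\<psi> a)}"
    unfolding g_def
  proof (intro holomorphic_intros holomorphic_on_subset[OF k(1)] holomorphic_on_subset[OF hol] holomorphic_on_compose[unfolded o_def])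
    fix z assume "z \<in> {z \<in> ball 0 1. cmod (\<psi> z) < cmod (\<psi> a)}"
    then have "cmod (\<psi> z / \<psi> a) < 1" using a by (simp add: norm_divide)
    then have "Re (\<psi> z / \<psi> a) < 1" using complex_Re_le_cmod[of "\<psi> z / \<psi> a"] by linarith
    then show "1 - \<psi> z / \<psi> a \<notin> \<real>\<^sub>\<le>\<^sub>0" by (auto simp: complex_nonpos_Reals_iff)
  qed (use a in auto)
  moreover have "(g z)\<^sup>2 = (z - a) / (1 - cnj a * z)" if z: "z \<in> ball 0 1" for z
  proof -
    have "(g z)\<^sup>2 = Q z * (1 - \<psi> z / \<psi> a)"
      by (simp add: g_def power_mult_distrib k(2)[OF z])
    also have "\<dots> = (\<psi> z - \<psi> a) / ((1 - cnj a * z) * P z)"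
      using a by (simp add: Q_def divide_simps mult_ac)
    also have "\<psi> z - \<psi> a = (z - a) * P z" by (simp add: P_def)
    finally show ?thesis using P0[OF z] by simp
  qed
  ultimately show ?thesis by (rule that)
qed

text \<open>Intermediate value theorem for \<open>|\<psi>|\<close>. It places the component of 0 off
  the level set inside the sublevel set.\<close>

lemma connected_sublevel:
  fixes \<psi> :: "complex \<Rightarrow> complex"
  assumes "connected S" "0 \<in> S" "continuous_on S \<psi>" "cmod (\<psi> 0) < \<alpha>" "\<And>z. z \<in> S \<Longrightarrow> cmod (\<psi> z) \<noteq> \<alpha>" "z \<in> S"
  shows "cmod (\<psi> z) < \<alpha>"
proof (rule ccontr)
  assume "\<not> ?thesis"
  then have "\<alpha> \<le> cmod (\<psi> z)" by simp
  moreover have "connected ((\<lambda>z. cmod (\<psi> z)) ` S)"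
    by (rule connected_continuous_image[OF continuous_on_norm[OF assms(3)] assms(1)])
  moreover have "cmod (\<psi> 0) \<le> \<alpha>" using assms(4) by simp
  ultimately have "\<alpha> \<in> (\<lambda>z. cmod (\<psi> z)) ` S"
    using connectedD_interval imageI[OF assms(2), of "\<lambda>z. cmod (\<psi> z)"]
      imageI[OF assms(6), of "\<lambda>z. cmod (\<psi> z)"] by blast
  then show False using assms(5) by auto
qed

lemma open_disc_minus_level_set:
  assumes "\<psi> holomorphic_on ball 0 1"
  shows "open (ball 0 1 - level_set \<psi> \<alpha>)"
proof -
  have "continuous_on (ball 0 1) (\<lambda>z. cmod (\<psi> z))"
    using assms by (intro continuous_intros holomorphic_on_imp_continuous_on)
  then have "open (ball 0 1 \<inter> (\<lambda>z. cmod (\<psi> z)) -` (- {\<alpha>}))"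
    by (intro continuous_open_preimage) auto
  also have "ball 0 1 \<inter> (\<lambda>z. cmod (\<psi> z)) -` (- {\<alpha>}) = ball 0 1 - level_set \<psi> \<alpha>"
    by (auto simp: level_set_def)
  finally show ?thesis .
qed

text \<open>The competitor is a multiple of \<open>|H| - 1\<close> with \<open>H\<close> the reciprocal of a Moebius map of the
  disc, applied to a branch \<open>g\<close> of the square root of the Moebius map with zero \<open>a\<close>. As that map is
  injective, the image of \<open>g\<close> misses its own negative; the latter contains a disc around \<open>b\<close>
  by Bloch's theorem, so \<open>H\<close> is bounded.\<close>

lemma harmonic_measure_level_set_ge:
  assumes hol: "\<psi> holomorphic_on ball 0 1" and inj: "inj_on \<psi> (ball 0 1)" and \<psi>0: "\<psi> 0 = 0"
    and half: "\<And>z. cmod z < 1/2 \<Longrightarrow> cmod (\<psi> z) < \<alpha>" and a: "a \<in> level_set \<psi> \<alpha>"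
  shows "ereal ((1 - cmod a) ^ 3 / 36864) \<le> harmonic_measure (ball 0 1) 0 (level_set \<psi> \<alpha>)"
proof -
  have \<alpha>: "\<alpha> > 0" using half[of 0] \<psi>0 by simp
  have a1: "cmod a < 1" "cmod (\<psi> a) = \<alpha>" "\<psi> a \<noteq> 0" using a \<alpha> by (auto simp: level_set_def)
  define U where "U = {z \<in> ball 0 1. cmod (\<psi> z) < \<alpha>}"
  define T where "T z = (z - a) / (1 - cnj a * z)" for z
  obtain g where g: "g holomorphic_on U" and gT: "\<And>z. z \<in> ball 0 1 \<Longrightarrow> (g z)\<^sup>2 = T z"
    by (rule moebius_sqrt_on_sublevel[OF hol inj a1(1,3), unfolded a1(2), folded U_def T_def]) (rule that)
  have nz: "1 - cnj a * z \<noteq> 0" if "cmod z \<le> 1" for z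
  proof -
    have "cmod (cnj a * z) \<le> cmod a * 1" using that unfolding norm_mult by (intro mult_mono) auto
    then show ?thesis using a1 by auto
  qed
  have T1: "cmod (T z) < 1" if "z \<in> ball 0 1" for z
  proof -
    have "0 < (1 - (cmod a)\<^sup>2) * (1 - (cmod z)\<^sup>2)"
      using that a1 by (intro mult_pos_pos) (auto simp: power_less_one_iff)
    then have "(cmod (z - a))\<^sup>2 < (cmod (1 - cnj a * z))\<^sup>2" using disc_moebius_identity[of a z] by simp
    then have "cmod (z - a) < cmod (1 - cnj a * z)" by (rule power2_less_imp_less) simp
    then show ?thesis using nz[of z] that by (simp add: T_def norm_divide)
  qed
  have gn: "(cmod (g z))\<^sup>2 = cmod (T z)" if "z \<in> ball 0 1" for z
    using arg_cong[OF gT[OF that], of cmod] by (simp only: norm_power)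
  have g1: "cmod (g z) < 1" if "z \<in> ball 0 1" for z
    using gn[OF that] T1[OF that] by (simp flip: gn[OF that] add: power_less_one_iff)
  have halfU: "ball 0 (1/2) \<subseteq> U" using half by (auto simp: U_def)
  have hd: "(g has_field_derivative deriv g 0) (at 0)"
    by (rule holomorphic_derivI[OF holomorphic_on_subset[OF g halfU]]) auto
  \<comment> \<open>Differentiating \<open>g^2 = T\<close> at 0 gives
    \<open>2 g(0) g'(0) = 1 - |a|^2\<close>, hence \<open>1 - |a| \<le> 2 |g'(0)|\<close>. Bloch's
    theorem on the disc of radius 1/2 yields any radius up to \<open>|g'(0)| / 24\<close>, and
    \<open>(1 - |a|) / 48\<close> is admissible.\<close>
  define R where "R = (1 - cmod a) / 48"
  have R: "R > 0" using a1 by (simp add: R_def)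
  have "((\<lambda>z. (g z)\<^sup>2) has_field_derivative 2 * g 0 * deriv g 0) (at 0)"
    by (auto intro!: derivative_eq_intros hd)
  moreover have "(T has_field_derivative 1 - a * cnj a) (at 0)"
    unfolding T_def by (auto intro!: derivative_eq_intros)
  moreover
  have "\<forall>\<^sub>F z in nhds 0. (g z)\<^sup>2 = T z"
    by (rule eventually_nhds_in_open[of "ball 0 1", THEN eventually_mono]) (use gT in auto)
  then have "((\<lambda>z. (g z)\<^sup>2) has_field_derivative x) (at 0) \<longleftrightarrow> (T has_field_derivative x) (at 0)" for x
    by (intro DERIV_cong_ev) auto
  ultimately have "2 * g 0 * deriv g 0 = 1 - a * cnj a"
    using DERIV_unique by blast
  then have "2 * cmod (g 0) * cmod (deriv g 0) = cmod (1 - a * cnj a)"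
    by (metis norm_mult norm_numeral)
  also have "1 - a * cnj a = of_real (1 - (cmod a)\<^sup>2)" by (simp add: complex_norm_square[symmetric])
  also have "cmod (of_real (1 - (cmod a)\<^sup>2)) = 1 - (cmod a)\<^sup>2"
    using a1 by (simp only: norm_of_real) (simp add: power_le_one)
  finally have d1: "2 * cmod (g 0) * cmod (deriv g 0) = 1 - (cmod a)\<^sup>2" .
  have "1 - cmod a \<le> 1 - (cmod a)\<^sup>2" using a1 by (simp add: power2_eq_square mult_left_le_one_le)
  also have "\<dots> \<le> 2 * cmod (deriv g 0)"
    unfolding d1[symmetric] using g1[of 0] by (simp add: mult_left_le_one_le mult.assoc)
  finally have "R \<le> (1/2) * cmod (deriv g 0) / 12" by (simp add: R_def)
  from Bloch[OF holomorphic_on_subset[OF g halfU] _ this]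
  obtain b' where b': "ball b' R \<subseteq> g ` ball 0 (1/2)" by auto
  define b where "b = - b'"
  have "g ` ball 0 (1/2) \<subseteq> ball 0 1" using g1 by auto
  then have "ball b' R \<subseteq> ball 0 1" using b' by blast
  then have bR: "cmod b + R \<le> 1" using R by (auto simp: ball_subset_ball_iff b_def)
  \<comment> \<open>Otherwise \<open>- g z = g z'\<close> for some \<open>z'\<close>. Squaring gives
    \<open>T z = T z'\<close>, so \<open>z = z'\<close> and \<open>g z = 0\<close>, which forces
    \<open>z = a\<close>, a point outside \<open>U\<close>.\<close>
  have far: "R \<le> cmod (g z - b)" if z: "z \<in> U" for z
  proof (rule ccontr)
    assume "\<not> ?thesis"
    then have "- g z \<in> ball b' R" by (simp add: b_def dist_norm add.commute)
    then obtain z' where z': "z' \<in> ball 0 (1/2)" "- g z = g z'" using b' by blast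
    have zz: "z \<in> ball 0 1" "z' \<in> ball 0 1" using z z' by (auto simp: U_def)
    have "T z = T z'" using gT[OF zz(1)] gT[OF zz(2)] z'(2) by (metis power2_minus)
    then have "z = z'" using disc_moebius_inj[of a z z'] a1 zz by (simp add: T_def)
    then have "g z = 0" using z'(2) by simp
    then have "T z = 0" using gT[OF zz(1)] by simp
    then have "z = a" using nz[of z] zz by (simp add: T_def)
    then show False using z a1 by (simp add: U_def)
  qed
  define H where "H z = (1 - cnj b * g z) / (g z - b)" for z
  have gb: "g z - b \<noteq> 0" if "z \<in> U" for z
  proof
    assume "g z - b = 0"
    then show False using far[OF that] R by simp
  qed
  have HU: "H holomorphic_on U"
    unfolding H_def by (intro holomorphic_intros g) (rule gb)
  \<comment> \<open>\<open>|H| \<le> 2 / R\<close> on \<open>U\<close>, so the factor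
    \<open>R / 2\<close> makes \<open>u \<le> 1\<close>.\<close>
  define u where "u z = ereal (R / 2 * (cmod (H z) - 1))" for z
  define S where "S = connected_component_set (ball 0 1 - level_set \<psi> \<alpha>) 0"
  note S = component_disc_minus[OF open_disc_minus_level_set[OF hol, of \<alpha>], folded S_def]
  have "0 \<notin> level_set \<psi> \<alpha>" using \<alpha> \<psi>0 by (simp add: level_set_def)
  note S = S[OF this]
  have SU: "S \<subseteq> U"
  proof
    fix z assume "z \<in> S"
    have "cmod (\<psi> z) < \<alpha>"
    proof (rule connected_sublevel[where \<psi> = \<psi>, OF S(5,2)])
      have "S \<subseteq> ball 0 1" using S(3) by blast
      then show "continuous_on S \<psi>"
        using hol holomorphic_on_imp_continuous_on holomorphic_on_subset by blast
      show "cmod (\<psi> 0) < \<alpha>" using \<alpha> \<psi>0 by simp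
      show "cmod (\<psi> w) \<noteq> \<alpha>" if "w \<in> S" for w
        using subsetD[OF S(3) that] by (simp add: level_set_def)
    qed fact
    moreover have "z \<in> ball 0 1" using S(3) \<open>z \<in> S\<close> by blast
    ultimately show "z \<in> U" by (simp add: U_def)
  qed
  have cu: "isCont u z" if "z \<in> S" for z
  proof -
    have "continuous_on S H"
      by (rule holomorphic_on_imp_continuous_on[OF holomorphic_on_subset[OF HU SU]])
    then have "isCont H z" using S(1) that by (simp only: continuous_on_eq_continuous_at)
    then have "isCont (\<lambda>z. R / 2 * (cmod (H z) - 1)) z" by (intro continuous_intros)
    then show ?thesis unfolding isCont_def u_def by (rule tendsto_ereal)
  qed
  have sub: "subharmonic_on u S"
    unfolding subharmonic_on_def
  proof (intro conjI ballI)
    show "open S" by (rule S)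
    fix z assume z: "z \<in> S"
    show "u z < \<infinity>" by (simp add: u_def)
    have lim: "(u \<longlongrightarrow> u z) (at z within S)" using cu[OF z] unfolding isCont_def by (rule tendsto_within_subset) simp
    have "at z within S \<noteq> bot" using at_within_open[OF z S(1)] by simp
    then show "Limsup (at z within S) u \<le> u z" using lim_imp_Limsup[OF _ lim] by simp
    obtain \<rho> where \<rho>: "\<rho> > 0" "ball z \<rho> \<subseteq> S" using S(1) z by (rule openE)
    have "u z \<le> circle_mean u z r" if "0 < r" "r < \<rho>" for r
    proof -
      have "cball z r \<subseteq> U" using \<rho> that SU by (auto simp: subset_eq)
      then show ?thesis unfolding u_def using that R
        by (intro norm_le_circle_mean holomorphic_on_subset[OF HU]) auto
    qed
    then show "\<exists>\<rho>>0. ball z \<rho> \<subseteq> S \<and> (\<forall>r. 0 < r \<and> r < \<rho> \<longrightarrow> u z \<le> circle_mean u z r)"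
      using \<rho> by blast
  qed
  have num: "cmod (1 - cnj b * g z) \<le> 2" if "z \<in> U" for z
  proof -
    have "cmod (cnj b * g z) \<le> 1 * 1" using g1[of z] that bR R unfolding norm_mult
      by (intro mult_mono) (auto simp: U_def)
    then show ?thesis using norm_triangle_ineq4[of 1 "cnj b * g z"] by simp
  qed
  have u1: "u z \<le> 1" if "z \<in> S" for z
  proof -
    have zU: "z \<in> U" using that SU by auto
    have "cmod (H z) \<le> 2 / R"
      unfolding H_def norm_divide using num[OF zU] far[OF zU] R by (intro frac_le) auto
    then have "R / 2 * (cmod (H z) - 1) \<le> 1" using R by (simp add: field_simps)
    then show ?thesis by (simp add: u_def)
  qed
  have inS: "\<forall>\<^sub>F z in at \<zeta> within S. z \<in> S" for \<zeta>
    by (simp add: eventually_at_filter)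
  have bd: "Limsup (at \<zeta> within S) u \<le> ereal (indicator (level_set \<psi> \<alpha>) \<zeta>)" if \<zeta>: "\<zeta> \<in> frontier S" for \<zeta>
  proof (cases "\<zeta> \<in> level_set \<psi> \<alpha>")
    case True
    have "Limsup (at \<zeta> within S) u \<le> 1"
      by (rule Limsup_bounded[OF eventually_mono[OF inS u1]])
    then show ?thesis using True by (simp add: one_ereal_def)
  next
    case False
    then have \<zeta>1: "cmod \<zeta> = 1" using S(4) \<zeta> by auto
    \<comment> \<open>\<open>g\<close> need not extend to the unit circle, but
      \<open>|g|^2 = |T|\<close> does. So \<open>u\<close> is dominated by an expression in
      \<open>T\<close> alone, continuous at \<zeta> and zero there.\<close>
    define v where "v z = R / 2 * ((1 - cmod (T z)) / R\<^sup>2)" for z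
    have uv: "u z \<le> ereal (v z)" if "z \<in> S" for z
    proof -
      have zU: "z \<in> U" "z \<in> ball 0 1" using that SU by (auto simp: U_def)
      have p: "0 < cmod (g z - b)" using far[OF zU(1)] R by linarith
      have "(cmod (H z))\<^sup>2 = 1 + ((cmod (1 - cnj b * g z))\<^sup>2 - (cmod (g z - b))\<^sup>2) / (cmod (g z - b))\<^sup>2"
        using p by (simp add: H_def norm_divide power_divide field_simps)
      also have "\<dots> \<le> 1 + (1 - cmod (T z)) / R\<^sup>2"
      proof -
        have "(1 - (cmod b)\<^sup>2) * (1 - cmod (T z)) \<le> 1 * (1 - cmod (T z))"
          using T1[OF zU(2)] by (intro mult_right_mono) auto
        moreover have "R\<^sup>2 \<le> (cmod (g z - b))\<^sup>2" using far[OF zU(1)] R by (intro power_mono) auto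
        ultimately show ?thesis
          unfolding disc_moebius_identity gn[OF zU(2)] using T1[OF zU(2)] R
          by (intro add_left_mono frac_le) auto
      qed
      also have "\<dots> \<le> (1 + (1 - cmod (T z)) / R\<^sup>2)\<^sup>2"
      proof -
        have "0 \<le> (1 - cmod (T z)) / R\<^sup>2" using T1[OF zU(2)] by simp
        then show ?thesis using self_le_power[of "1 + (1 - cmod (T z)) / R\<^sup>2" 2] by simp
      qed
      finally have "cmod (H z) \<le> 1 + (1 - cmod (T z)) / R\<^sup>2"
        using T1[OF zU(2)] by (auto intro: power2_le_imp_le)
      then have "R / 2 * (cmod (H z) - 1) \<le> v z"
        unfolding v_def using R by (intro mult_left_mono) auto
      then show ?thesis by (simp only: u_def ereal_less_eq)
    qed
    have "1 - cnj a * \<zeta> \<noteq> 0" using nz[of \<zeta>] \<zeta>1 by simp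
    then have "isCont v \<zeta>" unfolding v_def T_def using R by (intro continuous_intros) simp_all
    then have "(v \<longlongrightarrow> v \<zeta>) (at \<zeta> within S)"
      unfolding isCont_def by (rule tendsto_within_subset) simp
    moreover have "v \<zeta> = 0"
    proof -
      have "(cmod (1 - cnj a * \<zeta>))\<^sup>2 = (cmod (\<zeta> - a))\<^sup>2" using disc_moebius_identity[of a \<zeta>] \<zeta>1 by simp
      then have "cmod (1 - cnj a * \<zeta>) = cmod (\<zeta> - a)" by (rule power2_eq_imp_eq) auto
      then have "cmod (T \<zeta>) = cmod (1 - cnj a * \<zeta>) / cmod (1 - cnj a * \<zeta>)"
        by (simp only: T_def norm_divide)
      then have "cmod (T \<zeta>) = 1" using \<open>1 - cnj a * \<zeta> \<noteq> 0\<close> by simp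
      then show ?thesis by (simp add: v_def)
    qed
    ultimately have lim: "((\<lambda>z. ereal (v z)) \<longlongrightarrow> ereal 0) (at \<zeta> within S)" by simp
    have "Limsup (at \<zeta> within S) (\<lambda>z. ereal (v z)) \<le> 0"
      using lim_imp_Limsup[OF _ lim] by (cases "at \<zeta> within S = bot") (auto simp: Limsup_bot zero_ereal_def)
    moreover have "Limsup (at \<zeta> within S) u \<le> Limsup (at \<zeta> within S) (\<lambda>z. ereal (v z))"
      by (rule Limsup_mono[OF eventually_mono[OF inS uv]])
    ultimately show ?thesis using False by (simp add: zero_ereal_def)
  qed
  have "u 0 \<le> harmonic_measure (ball 0 1) 0 (level_set \<psi> \<alpha>)"
    unfolding harmonic_measure_def perron_solution_def S_def[symmetric]
    by (rule SUP_upper) (simp add: sub bd)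
  \<comment> \<open>At 0, \<open>|g|^2 = |T 0| = |a|\<close>, so
    \<open>x^2 - y^2 = (1 - |b|^2) (1 - |a|) \<ge> R (1 - |a|)\<close>. With
    \<open>x + y \<le> 4\<close> and \<open>y \<le> 2\<close> this gives
    \<open>|H 0| - 1 \<ge> R (1 - |a|) / 8\<close>, and \<open>36864 = 16 * 48^2\<close>.\<close>
  moreover have "(1 - cmod a) ^ 3 / 36864 \<le> R / 2 * (cmod (H 0) - 1)"
  proof -
    have 0: "0 \<in> U" "(0::complex) \<in> ball 0 1" using \<alpha> \<psi>0 by (auto simp: U_def)
    define x where "x = cmod (1 - cnj b * g 0)"
    define y where "y = cmod (g 0 - b)"
    have y: "0 < y" "y \<le> 2"
      using far[OF 0(1)] R g1[OF 0(2)] bR norm_triangle_ineq4[of "g 0" b] by (auto simp: y_def)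
    have x: "0 \<le> x" "x \<le> 2" using num[OF 0(1)] by (auto simp: x_def)
    have "(cmod b)\<^sup>2 \<le> cmod b" using bR R by (simp add: power2_eq_square mult_left_le_one_le)
    then have "R * (1 - cmod a) \<le> (1 - (cmod b)\<^sup>2) * (1 - (cmod (g 0))\<^sup>2)"
      using bR R a1 gn[OF 0(2)] by (intro mult_mono) (auto simp: T_def power_le_one)
    also have "\<dots> = (x - y) * (x + y)"
      unfolding disc_moebius_identity[symmetric] x_def y_def by (simp add: power2_eq_square algebra_simps)
    finally have m: "R * (1 - cmod a) \<le> (x - y) * (x + y)" .
    have "0 < R * (1 - cmod a)" using R a1 by simp
    with m have "0 < (x - y) * (x + y)" by linarith
    then have "0 < x - y" by (rule zero_less_mult_pos2) (use x y in linarith)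
    then have "(x - y) * (x + y) \<le> (x - y) * 4" using x y by (intro mult_left_mono) auto
    then have "R * (1 - cmod a) / 4 \<le> x - y" using m by simp
    moreover have "cmod (H 0) - 1 = (x - y) / y"
    proof -
      have "cmod (H 0) = x / y" by (simp only: H_def norm_divide x_def y_def)
      then show ?thesis using y by (simp add: diff_divide_distrib)
    qed
    moreover have "(x - y) / 2 \<le> (x - y) / y" using y \<open>0 < x - y\<close> by (intro divide_left_mono) auto
    moreover have "R * (1 - cmod a) / 8 \<le> (x - y) / 2" using calculation by simp
    ultimately have "R * (1 - cmod a) / 8 \<le> cmod (H 0) - 1" by (simp only: order_trans)
    then have "R / 2 * (R * (1 - cmod a) / 8) \<le> R / 2 * (cmod (H 0) - 1)" using R by (intro mult_left_mono) auto
    then show ?thesis by (simp add: R_def power3_eq_cube)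
  qed
  ultimately show ?thesis unfolding u_def by (simp only: order_trans[OF ereal_less_eq(3)[THEN iffD2]])
qed

section \<open>Powers of univalent functions of slow growth\<close>

lemma borel_measurable_vector_2:
  "(\<lambda>(s, t). vector [s, t] :: real ^ 2) \<in> borel_measurable (lborel \<Otimes>\<^sub>M lborel)"
proof -
  have eq: "(\<lambda>(s, t). vector [s, t] :: real ^ 2) = (\<lambda>p. \<chi> i. if i = 1 then fst p else snd p)"
    by (auto simp: fun_eq_iff vec_eq_iff forall_2)
  have "continuous_on UNIV (\<lambda>p :: real \<times> real. \<chi> i::2. if i = 1 then fst p else snd p)"
  proof (rule continuous_on_vec_lambda)
    show "continuous_on UNIV (\<lambda>p :: real \<times> real. if i = 1 then fst p else snd p)" for i :: 2
      by (cases "i = 1") (auto intro!: continuous_intros)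
  qed
  then show ?thesis
    unfolding eq lborel_prod measurable_lborel2 by (rule borel_measurable_continuous_onI)
qed

text \<open>The change of variables formula is applied on \<open>real ^ 2\<close>, Tonelli's theorem
  on the product measure; this identification passes from one to the other.\<close>

lemma lborel_vector_2:
  "lborel = distr (lborel \<Otimes>\<^sub>M lborel) borel (\<lambda>(s, t). vector [s, t] :: real ^ 2)"
proof (rule lborel_eqI)
  note borel_measurable_vector_2[measurable]
  fix l u :: "real ^ 2"
  assume lu: "\<And>b. b \<in> Basis \<Longrightarrow> l \<bullet> b \<le> u \<bullet> b"
  have le: "l $ i \<le> u $ i" for i
    using lu[of "axis i 1"] by (simp add: inner_axis axis_in_Basis_iff)
  have B: "(Basis :: (real ^ 2) set) = {axis 1 1, axis 2 1}"
    by (auto simp: Basis_vec_def exhaust_2) (metis exhaust_2)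
  have ne: "axis 1 1 \<noteq> (axis 2 1 :: real ^ 2)" by (auto simp: axis_eq_axis)
  have pre: "(\<lambda>(s, t). vector [s, t] :: real ^ 2) -` box l u \<inter> space (lborel \<Otimes>\<^sub>M lborel)
      = box (l $ 1) (u $ 1) \<times> box (l $ 2) (u $ 2)"
    by (auto simp: mem_box_cart forall_2 space_pair_measure)
  show "emeasure (distr (lborel \<Otimes>\<^sub>M lborel) borel (\<lambda>(s, t). vector [s, t] :: real ^ 2)) (box l u)
      = ennreal (\<Prod>b\<in>Basis. (u - l) \<bullet> b)"
    using le ne
    by (simp add: emeasure_distr pre lborel.emeasure_pair_measure_Times B inner_axis ennreal_mult)
qed simp

lemma borel_measurable_continuous_on_times_indicator:
  fixes f :: "'a :: topological_space \<Rightarrow> ennreal"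
  assumes "continuous_on S f" "open S"
  shows "(\<lambda>x. f x * indicator S x) \<in> borel_measurable borel"
  using borel_measurable_continuous_on_restrict[OF assms(1)] assms(2)
  by (subst borel_measurable_restrict_space_iff_ennreal[symmetric]) auto

text \<open>\<open>4 M\<^sup>2\<close> is the area of a square containing the image of the rectangle.\<close>

lemma nn_integral_deriv_rectangle_le:
  assumes hol: "f holomorphic_on U" and U: "open U"
    and R: "\<And>s t. s1 < s \<Longrightarrow> s < s2 \<Longrightarrow> t1 < t \<Longrightarrow> t < t2 \<Longrightarrow> Complex s t \<in> U"
    and inj: "inj_on f {z. s1 < Re z \<and> Re z < s2 \<and> t1 < Im z \<and> Im z < t2}"
    and M: "\<And>s t. s1 < s \<Longrightarrow> s < s2 \<Longrightarrow> t1 < t \<Longrightarrow> t < t2 \<Longrightarrow> cmod (f (Complex s t)) \<le> M"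
    and "M \<ge> 0"
  shows "(\<integral>\<^sup>+s\<in>{s1<..<s2}. (\<integral>\<^sup>+t\<in>{t1<..<t2}. ennreal ((cmod (deriv f (Complex s t)))\<^sup>2) \<partial>lborel) \<partial>lborel)
    \<le> ennreal (4 * M\<^sup>2)"
proof -
  define I where "I x = Complex (x $ 1) (x $ 2)" for x :: "real ^ 2"
  define J where "J z = (vector [Re z, Im z] :: real ^ 2)" for z
  define S where "S = box (vector [s1, t1]) (vector [s2, t2] :: real ^ 2)"
  have S: "x \<in> S \<longleftrightarrow> s1 < x $ 1 \<and> x $ 1 < s2 \<and> t1 < x $ 2 \<and> x $ 2 < t2" for x
    by (auto simp: S_def mem_box_cart forall_2)
  have J_eq: "J z = (\<chi> i. if i = 1 then Re z else Im z)" for z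
    by (simp add: J_def vec_eq_iff forall_2)
  have I_eq: "I = (\<lambda>x. of_real (x $ 1) + \<i> * of_real (x $ 2))"
    by (auto simp: I_def complex_eq_iff)
  have bJ: "bounded_linear J"
    unfolding J_eq by (rule bounded_linearI'; auto simp: vec_eq_iff)
  have bI: "bounded_linear I"
    unfolding I_def by (rule bounded_linearI'; auto simp: complex_eq_iff)
  define \<phi> where "\<phi> x = J (f (I x))" for x
  define \<phi>' where "\<phi>' x h = J (deriv f (I x) * I h)" for x h
  have IS: "I x \<in> U" if "x \<in> S" for x using that R by (auto simp: I_def S)
  have der: "(\<phi> has_derivative \<phi>' x) (at x within S)" if "x \<in> S" for x
  proof -
    have "(f has_field_derivative deriv f (I x)) (at (I x))"
      by (rule holomorphic_derivI[OF hol U IS[OF that]])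
    then have "(f has_derivative (*) (deriv f (I x))) (at (I x))"
      by (simp add: has_field_derivative_def)
    from has_derivative_compose[OF bounded_linear_imp_has_derivative[OF bI] this]
    show ?thesis
      unfolding \<phi>_def \<phi>'_def by (intro bounded_linear.has_derivative[OF bJ]) (auto intro: has_derivative_at_withinI)
  qed
  \<comment> \<open>By the Cauchy-Riemann equations the real Jacobian of a holomorphic map is
    \<open>|f'|^2\<close>.\<close>
  have det: "\<bar>det (matrix (\<phi>' x))\<bar> = (cmod (deriv f (I x)))\<^sup>2" for x
  proof -
    have "det (matrix (\<phi>' x)) = (Re (deriv f (I x)))\<^sup>2 + (Im (deriv f (I x)))\<^sup>2"
      unfolding det_2 matrix_def \<phi>'_def by (simp add: J_def I_def axis_def power2_eq_square)
    then show ?thesis by (simp add: cmod_power2)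
  qed
  have inj\<phi>: "inj_on \<phi> S"
  proof (rule inj_onI)
    fix x y assume xy: "x \<in> S" "y \<in> S" "\<phi> x = \<phi> y"
    have "f (I x) = f (I y)"
      using arg_cong[OF xy(3), of "\<lambda>v :: real ^ 2. (v $ 1, v $ 2)"] by (simp add: \<phi>_def J_def complex_eq_iff)
    from inj_onD[OF inj this] have "I x = I y" using xy(1,2) by (simp add: I_def S)
    then show "x = y" by (simp add: I_def vec_eq_iff forall_2)
  qed
  have S_leb: "S \<in> sets lebesgue" by (simp add: S_def)
  have sub: "\<phi> ` S \<subseteq> cbox (vector [- M, - M]) (vector [M, M])"
  proof
    fix y assume "y \<in> \<phi> ` S"
    then obtain x where x: "x \<in> S" "y = \<phi> x" by auto
    have "cmod (f (I x)) \<le> M" unfolding I_def using x M by (auto simp: S)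
    then have "\<bar>Re (f (I x))\<bar> \<le> M" "\<bar>Im (f (I x))\<bar> \<le> M"
      using abs_Re_le_cmod[of "f (I x)"] abs_Im_le_cmod[of "f (I x)"] by linarith+
    then show "y \<in> cbox (vector [- M, - M]) (vector [M, M])"
      by (auto simp: x \<phi>_def J_def mem_box_cart forall_2)
  qed
  have "\<phi> ` S \<in> sets lebesgue"
    by (rule differentiable_image_in_sets_lebesgue[OF S_leb])
      (use der in \<open>auto simp: differentiable_on_def differentiable_def\<close>)
  then have meas: "\<phi> ` S \<in> lmeasurable"
    using bounded_subset[OF bounded_cbox sub] by (rule bounded_set_imp_lmeasurable[rotated])
  have "measure lebesgue (\<phi> ` S) \<le> measure lebesgue (cbox (vector [- M, - M]) (vector [M, M] :: real ^ 2))"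
    using sub meas by (intro measure_mono_fmeasurable) auto
  also have "\<dots> = 4 * M\<^sup>2"
  proof -
    have "vector [M, M] \<in> cbox (vector [- M, - M]) (vector [M, M] :: real ^ 2)"
      using \<open>M \<ge> 0\<close> by (simp add: mem_box_cart forall_2)
    then show ?thesis by (auto simp: content_cbox_if_cart UNIV_2 power2_eq_square)
  qed
  finally have le: "measure lebesgue (\<phi> ` S) \<le> 4 * M\<^sup>2" .
  have hi: "((\<lambda>x. \<bar>det (matrix (\<phi>' x))\<bar>) has_integral measure lebesgue (\<phi> ` S)) S"
    using has_measure_differentiable_image[OF S_leb der inj\<phi>] meas by blast
  have "(\<integral>\<^sup>+x. ennreal ((cmod (deriv f (I x)))\<^sup>2) * indicator S x \<partial>lborel) = ennreal (measure lebesgue (\<phi> ` S))"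
    using nn_integral_has_integral_lebesgue'[OF _ hi] unfolding det by simp
  also have "(\<integral>\<^sup>+x. ennreal ((cmod (deriv f (I x)))\<^sup>2) * indicator S x \<partial>lborel)
    = (\<integral>\<^sup>+p. ennreal ((cmod (deriv f (Complex (fst p) (snd p))))\<^sup>2) * indicator ({s1<..<s2} \<times> {t1<..<t2}) p \<partial>(lborel \<Otimes>\<^sub>M lborel))"
  proof -
    have "continuous_on S (\<lambda>x. ennreal ((cmod (deriv f (I x)))\<^sup>2))"
    proof -
      have "continuous_on U (deriv f)"
        by (intro holomorphic_on_imp_continuous_on holomorphic_deriv hol U)
      then have "continuous_on S (\<lambda>x. deriv f (I x))"
        by (rule continuous_on_compose2) (use IS linear_continuous_on[OF bI] in auto)
      then show ?thesis by (intro continuous_on_ennreal continuous_intros)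
    qed
    then have m: "(\<lambda>x. ennreal ((cmod (deriv f (I x)))\<^sup>2) * indicator S x) \<in> borel_measurable borel"
      by (rule borel_measurable_continuous_on_times_indicator) (simp add: S_def open_box)
    then have m': "(\<lambda>x. ennreal ((cmod (deriv f (I x)))\<^sup>2) * indicator S x) \<in> borel_measurable
        (distr (lborel \<Otimes>\<^sub>M lborel) borel (\<lambda>(s, t). vector [s, t] :: real ^ 2))"
      by simp
    show ?thesis
      by (subst lborel_vector_2, subst nn_integral_distr[OF borel_measurable_vector_2 m'])
        (auto intro!: nn_integral_cong simp: I_def S indicator_def split: prod.splits)
  qed
  also have "\<dots> = (\<integral>\<^sup>+s. \<integral>\<^sup>+t. ennreal ((cmod (deriv f (Complex s t)))\<^sup>2) * indicator ({s1<..<s2} \<times> {t1<..<t2}) (s, t) \<partial>lborel \<partial>lborel)"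
  proof -
    have "continuous_on ({s1<..<s2} \<times> {t1<..<t2}) (\<lambda>p. ennreal ((cmod (deriv f (Complex (fst p) (snd p))))\<^sup>2))"
    proof -
      have "continuous_on U (deriv f)"
        by (intro holomorphic_on_imp_continuous_on holomorphic_deriv hol U)
      then have "continuous_on ({s1<..<s2} \<times> {t1<..<t2}) (\<lambda>p. deriv f (Complex (fst p) (snd p)))"
        by (rule continuous_on_compose2) (use R in \<open>auto simp: Complex_eq intro!: continuous_intros\<close>)
      then show ?thesis by (intro continuous_on_ennreal continuous_intros)
    qed
    then have "(\<lambda>p. ennreal ((cmod (deriv f (Complex (fst p) (snd p))))\<^sup>2) * indicator ({s1<..<s2} \<times> {t1<..<t2}) p)
        \<in> borel_measurable (lborel \<Otimes>\<^sub>M lborel)"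
      unfolding lborel_prod measurable_lborel2
      by (rule borel_measurable_continuous_on_times_indicator) (simp add: open_Times)
    from lborel.nn_integral_fst[OF this] show ?thesis by simp
  qed
  also have "\<dots> = (\<integral>\<^sup>+s\<in>{s1<..<s2}. (\<integral>\<^sup>+t\<in>{t1<..<t2}. ennreal ((cmod (deriv f (Complex s t)))\<^sup>2) \<partial>lborel) \<partial>lborel)"
    by (intro nn_integral_cong) (auto simp: indicator_def)
  finally show ?thesis using le by (simp add: ennreal_leI)
qed

section \<open>Power series in the disc and Bessel's inequality on circles\<close>

lemma power_series_shift:
  fixes b :: "nat \<Rightarrow> complex"
  assumes "\<And>z. z \<in> ball 0 1 \<Longrightarrow> (\<lambda>n. b n * z ^ n) sums g z"
  obtains q where "\<And>z. z \<in> ball 0 1 \<Longrightarrow> (\<lambda>n. b (Suc n) * z ^ n) sums q z"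
    "\<And>z. z \<in> ball 0 1 \<Longrightarrow> g z = b 0 + z * q z"
proof
  fix z :: complex assume z: "z \<in> ball 0 1"
  have s: "summable (\<lambda>n. b n * z ^ n)" using assms[OF z] by (rule sums_summable)
  show "(\<lambda>n. b (Suc n) * z ^ n) sums (\<Sum>n. b (Suc n) * z ^ n)"
    using powser_split_head(3)[OF s] by (rule summable_sums)
  show "g z = b 0 + z * (\<Sum>n. b (Suc n) * z ^ n)"
    using powser_split_head(1)[OF s] sums_unique[OF assms[OF z]] by (simp add: mult.commute)
qed

lemma power_series_holomorphic_disc:
  assumes "\<And>z. z \<in> ball 0 1 \<Longrightarrow> (\<lambda>n. b n * z ^ n) sums g z"
  shows "g holomorphic_on ball 0 1"
  using assms by (intro power_series_holomorphic[where a = b]) simp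

lemma continuous_on_circle:
  fixes g :: "complex \<Rightarrow> 'a :: topological_space"
  assumes "continuous_on (ball 0 1) g" "0 < s" "s < 1"
  shows "continuous_on T (\<lambda>t. g (rcis s t))"
  unfolding rcis_def
  by (rule continuous_on_compose2[OF assms(1)])
    (use assms in \<open>auto intro!: continuous_intros simp: norm_mult\<close>)

text \<open>Bessel's inequality by induction: in \<open>g = b 0 + z * q\<close> the cross term has
  mean zero, because \<open>z * q z\<close> vanishes at 0, and \<open>q\<close> carries the shifted
  coefficients.\<close>

lemma coefficient_sum_le_circle_integral:
  fixes b :: "nat \<Rightarrow> complex"
  assumes "\<And>z. z \<in> ball 0 1 \<Longrightarrow> (\<lambda>n. b n * z ^ n) sums g z" and s: "0 < s" "s < 1"
  shows "2 * pi * (\<Sum>n<N. (cmod (b n))\<^sup>2 * s ^ (2 * n)) \<le> integral {0..2 * pi} (\<lambda>t. (cmod (g (rcis s t)))\<^sup>2)"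
  using assms(1)
proof (induction N arbitrary: b g)
  case 0
  have "g holomorphic_on ball 0 1" using 0 by (rule power_series_holomorphic_disc)
  then have "(\<lambda>t. (cmod (g (rcis s t)))\<^sup>2) integrable_on {0..2 * pi}"
    by (intro integrable_continuous_interval continuous_intros continuous_on_circle
        holomorphic_on_imp_continuous_on s)
  then show ?case by (simp add: integral_nonneg)
next
  case (Suc N)
  from power_series_shift[OF Suc.prems] obtain q where
    q: "\<And>z. z \<in> ball 0 1 \<Longrightarrow> (\<lambda>n. b (Suc n) * z ^ n) sums q z"
      "\<And>z. z \<in> ball 0 1 \<Longrightarrow> g z = b 0 + z * q z" by blast
  have qh: "q holomorphic_on ball 0 1" using q(1) by (rule power_series_holomorphic_disc)
  have cq: "continuous_on {0..2 * pi} (\<lambda>t. q (rcis s t))"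
    by (intro continuous_on_circle holomorphic_on_imp_continuous_on qh s)
  define C where "C = integral {0..2 * pi} (\<lambda>t. (cmod (q (rcis s t)))\<^sup>2)"
  have IH: "2 * pi * (\<Sum>n<N. (cmod (b (Suc n)))\<^sup>2 * s ^ (2 * n)) \<le> C"
    unfolding C_def using q(1) by (rule Suc.IH)
  have 1: "((\<lambda>t. (cmod (q (rcis s t)))\<^sup>2) has_integral C) {0..2 * pi}"
    unfolding C_def by (intro integrable_integral integrable_continuous_interval continuous_intros cq)
  have "((\<lambda>t. (\<lambda>z. 2 * cnj (b 0) * (z * q z)) (0 + rcis s t)) has_integral
      (2 * pi * (\<lambda>z. 2 * cnj (b 0) * (z * q z)) 0)) {0..2 * pi}"
    by (rule has_integral_circle_holomorphic, intro holomorphic_intros holomorphic_on_subset[OF qh]) (use s in auto)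
  then have "((\<lambda>t. 2 * cnj (b 0) * (rcis s t * q (rcis s t))) has_integral 0) {0..2 * pi}" by simp
  from has_integral_linear[OF this bounded_linear_Re]
  have 2: "((\<lambda>t. 2 * Re (cnj (b 0) * (rcis s t * q (rcis s t)))) has_integral 0) {0..2 * pi}"
    by (simp add: o_def mult.assoc)
  have 3: "((\<lambda>t. (cmod (b 0))\<^sup>2) has_integral 2 * pi * (cmod (b 0))\<^sup>2) {0..2 * pi}"
    using has_integral_const_real[of "(cmod (b 0))\<^sup>2" 0 "2 * pi"] by simp
  have eq: "(cmod (g (rcis s t)))\<^sup>2
      = (cmod (b 0))\<^sup>2 + 2 * Re (cnj (b 0) * (rcis s t * q (rcis s t))) + s\<^sup>2 * (cmod (q (rcis s t)))\<^sup>2" for t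
  proof -
    have "rcis s t \<in> ball 0 1" using s by (simp add: rcis_def norm_mult)
    then show ?thesis using s by (simp add: q(2) cmod_add_squared norm_mult power_mult_distrib del: times_complex.simps)
  qed
  have "((\<lambda>t. (cmod (g (rcis s t)))\<^sup>2) has_integral (2 * pi * (cmod (b 0))\<^sup>2 + 0 + s\<^sup>2 * C)) {0..2 * pi}"
    unfolding eq by (intro has_integral_add 2 3 has_integral_mult_right 1)
  then have "integral {0..2 * pi} (\<lambda>t. (cmod (g (rcis s t)))\<^sup>2) = 2 * pi * (cmod (b 0))\<^sup>2 + s\<^sup>2 * C"
    by (simp add: integral_unique)
  moreover have "2 * pi * (\<Sum>n<Suc N. (cmod (b n))\<^sup>2 * s ^ (2 * n))
      = 2 * pi * (cmod (b 0))\<^sup>2 + s\<^sup>2 * (2 * pi * (\<Sum>n<N. (cmod (b (Suc n)))\<^sup>2 * s ^ (2 * n)))"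
    unfolding sum.lessThan_Suc_shift
    by (simp add: sum_distrib_left distrib_left power2_eq_square mult_ac)
  ultimately show ?case using mult_left_mono[OF IH, of "s\<^sup>2"] by simp
qed

text \<open>The factor \<open>z\<close> keeps the \<open>n\<close>-th coefficient at the power
  \<open>n\<close>; the term for \<open>n = 0\<close> vanishes, so the shift by \<open>Suc\<close>
  costs nothing.\<close>

lemma sums_times_deriv:
  fixes a :: "nat \<Rightarrow> complex"
  assumes f: "\<And>z. z \<in> ball 0 1 \<Longrightarrow> (\<lambda>n. a n * z ^ n) sums f z" and z: "z \<in> ball 0 1"
  shows "(\<lambda>n. of_nat n * a n * z ^ n) sums (z * deriv f z)"
proof -
  have "f holomorphic_on ball 0 1" using f by (rule power_series_holomorphic_disc)
  then have "(f has_field_derivative deriv f z) (at z)" using z by (intro holomorphic_derivI) auto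
  from termdiffs_sums_strong[of 1 a f, OF _ this]
  have "(\<lambda>n. diffs a n * z ^ n) sums deriv f z" using f z by simp
  from sums_mult[OF this, of z]
  have "(\<lambda>n. of_nat (Suc n) * a (Suc n) * z ^ Suc n) sums (z * deriv f z)"
    by (simp add: diffs_def mult_ac)
  then show ?thesis by (subst (asm) sums_Suc_iff) simp
qed

text \<open>The blocks \<open>[2^k, 2^(k+1))\<close> contribute at most \<open>D \<theta>^k\<close>
  with \<open>\<theta> = 1 / sqrt 2\<close>, a convergent geometric series.\<close>

lemma sum_dyadic_bound:
  fixes x :: "nat \<Rightarrow> real"
  assumes D: "\<And>N. N \<ge> 1 \<Longrightarrow> (\<Sum>n\<in>{N..<2 * N}. x n) \<le> D / sqrt N" and x: "\<And>n. x n \<ge> 0"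
  shows "\<exists>A. \<forall>N. (\<Sum>n<N. x n) \<le> A"
proof -
  define \<theta> where "\<theta> = 1 / sqrt 2"
  have \<theta>: "0 < \<theta>" "\<theta> < 1" by (auto simp: \<theta>_def)
  have D0: "D \<ge> 0" using order_trans[OF sum_nonneg D[of 1]] x by simp
  have K: "(\<Sum>n<2 ^ K. x n) \<le> x 0 + D * (\<Sum>k<K. \<theta> ^ k)" for K
  proof (induction K)
    case 0
    show ?case by simp
  next
    case (Suc K)
    have "(\<Sum>n<2 ^ Suc K. x n) = (\<Sum>n<2 ^ K. x n) + (\<Sum>n\<in>{2 ^ K..<2 * 2 ^ K}. x n)"
      by (subst sum.union_disjoint[symmetric]) (auto simp: ivl_disj_un ivl_disj_int intro!: sum.cong)
    also have "(\<Sum>n\<in>{2 ^ K..<2 * 2 ^ K}. x n) \<le> D / sqrt (real (2 ^ K))" by (rule D) simp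
    also have "D / sqrt (real (2 ^ K)) = D * \<theta> ^ K"
      by (simp add: \<theta>_def real_sqrt_power power_divide)
    finally show ?case using Suc.IH by (simp add: distrib_left)
  qed
  have "(\<Sum>n<N. x n) \<le> x 0 + D * (1 / (1 - \<theta>))" for N
  proof -
    have "(\<Sum>n<N. x n) \<le> (\<Sum>n<2 ^ N. x n)"
      using less_exp[of N] by (intro sum_mono2) (auto simp: x)
    also have "\<dots> \<le> x 0 + D * (\<Sum>k<N. \<theta> ^ k)" by (rule K)
    also have "(\<Sum>k<N. \<theta> ^ k) \<le> 1 / (1 - \<theta>)"
      using \<theta> by (subst sum_gp_strict) (auto intro!: divide_right_mono)
    finally show ?thesis using D0 by (simp add: mult_left_mono)
  qed
  then show ?thesis by blast
qed

text \<open>In logarithmic coordinates \<open>\<zeta> = s + i t\<close> the area of the image of \<open>\<psi>\<close>, weighted by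
  \<open>m\<^sup>2 |\<psi>|\<^sup>2\<^sup>m\<^sup>-\<^sup>2\<close>, dominates the integral of \<open>|z f'(z)|\<^sup>2\<close>, which Bessel's inequality
  bounds below by \<open>\<Sum> n\<^sup>2 |a\<^sub>n|\<^sup>2 e\<^sup>2\<^sup>n\<^sup>s\<close>.\<close>

lemma univalent_power_dyadic_coefficients:
  assumes hol: "\<psi> holomorphic_on ball 0 1" and inj: "inj_on \<psi> (ball 0 1)"
    and f: "\<And>z. z \<in> ball 0 1 \<Longrightarrow> (\<lambda>n. a n * z ^ n) sums (\<psi> z ^ m)" and m: "m \<ge> 1"
    and N: "N \<ge> 1" and M: "M \<ge> 0" "\<And>z. cmod z \<le> exp (- 1 / real N) \<Longrightarrow> cmod (\<psi> z) \<le> M"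
  shows "(\<Sum>n\<in>{N..<2 * N}. (cmod (a n))\<^sup>2) \<le> exp 8 * real m ^ 2 * M ^ (2 * m) / real N"
proof -
  \<comment> \<open>For \<open>s\<close> in this strip and \<open>n < 2 * N\<close>,
    \<open>2 n |s| \<le> 8\<close>, which is the source of \<open>exp (- 8)\<close>. The right edge
    corresponds to the circle up to which \<open>M\<close> bounds \<psi>.\<close>
  define s1 s2 where "s1 = - 2 / real N" and "s2 = - 1 / real N"
  have s12: "s2 < 0" "s2 - s1 = 1 / real N" "s1 < s2" using N by (auto simp: s1_def s2_def field_simps)
  \<comment> \<open>Circles about 0 become vertical segments of length \<open>2 * pi\<close>, on
    which \<open>z f'(z)\<close> for \<open>f = \<psi>^m\<close> is exactly
    \<open>m \<psi>^(m-1)\<close> times the derivative of \<Psi>; no polar Jacobian appears.\<close>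
  define \<Psi> where "\<Psi> \<zeta> = \<psi> (exp \<zeta>)" for \<zeta>
  define U where "U = {\<zeta>. Re \<zeta> < 0}"
  have U: "open U" unfolding U_def by (rule open_halfspace_Re_lt)
  have expU: "exp \<zeta> \<in> ball 0 1" if "\<zeta> \<in> U" for \<zeta> using that by (simp add: U_def)
  have hol\<Psi>: "\<Psi> holomorphic_on U"
    unfolding \<Psi>_def using expU
    by (intro holomorphic_on_compose_gen[unfolded o_def, OF _ hol] holomorphic_intros) auto
  have deriv\<Psi>: "deriv \<Psi> \<zeta> = deriv \<psi> (exp \<zeta>) * exp \<zeta>" if "\<zeta> \<in> U" for \<zeta>
  proof -
    have "(\<psi> has_field_derivative deriv \<psi> (exp \<zeta>)) (at (exp \<zeta>))"
      using expU[OF that] by (intro holomorphic_derivI[OF hol]) auto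
    from DERIV_chain2[OF this DERIV_exp] show ?thesis
      unfolding \<Psi>_def by (rule DERIV_imp_deriv)
  qed
  define K where "K = real m ^ 2 * M ^ (2 * (m - 1))"
  have K: "K \<ge> 0" using M by (simp add: K_def)
  define g where "g z = z * deriv (\<lambda>z. \<psi> z ^ m) z" for z
  have gs: "(\<lambda>n. of_nat n * a n * z ^ n) sums g z" if "z \<in> ball 0 1" for z
    unfolding g_def using f that by (rule sums_times_deriv)
  have gle: "(cmod (g (exp \<zeta>)))\<^sup>2 \<le> K * (cmod (deriv \<Psi> \<zeta>))\<^sup>2" if \<zeta>: "Re \<zeta> < s2" for \<zeta>
  proof -
    have \<zeta>U: "\<zeta> \<in> U" using that s12 by (simp add: U_def)
    have "(\<psi> has_field_derivative deriv \<psi> (exp \<zeta>)) (at (exp \<zeta>))"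
      using expU[OF \<zeta>U] by (intro holomorphic_derivI[OF hol]) auto
    then have "deriv (\<lambda>z. \<psi> z ^ m) (exp \<zeta>) = of_nat m * \<psi> (exp \<zeta>) ^ (m - 1) * deriv \<psi> (exp \<zeta>)"
      by (intro DERIV_imp_deriv) (auto intro!: derivative_eq_intros)
    then have "g (exp \<zeta>) = of_nat m * \<psi> (exp \<zeta>) ^ (m - 1) * deriv \<Psi> \<zeta>"
      by (simp add: g_def deriv\<Psi>[OF \<zeta>U])
    then have "(cmod (g (exp \<zeta>)))\<^sup>2 = (real m)\<^sup>2 * (cmod (\<psi> (exp \<zeta>)) ^ (2 * (m - 1))) * (cmod (deriv \<Psi> \<zeta>))\<^sup>2"
      by (simp add: norm_mult norm_power power_mult_distrib power_mult[symmetric] mult.commute)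
    also have "\<dots> \<le> K * (cmod (deriv \<Psi> \<zeta>))\<^sup>2"
    proof -
      have "cmod (exp \<zeta>) \<le> exp (- 1 / real N)" using \<zeta> by (simp add: s2_def)
      then have "cmod (\<psi> (exp \<zeta>)) \<le> M" by (rule M)
      then show ?thesis unfolding K_def by (intro mult_right_mono mult_left_mono power_mono) auto
    qed
    finally show ?thesis .
  qed
  define X where "X = (\<Sum>n\<in>{N..<2 * N}. (cmod (a n))\<^sup>2)"
  have X: "X \<ge> 0" unfolding X_def by (intro sum_nonneg) auto
  \<comment> \<open>By Bessel's inequality, a lower bound for the integral of \<open>|g|^2\<close>
    over each circle in the strip, since \<open>n \<ge> N\<close> in the block.\<close>
  define B where "B = 2 * pi * (exp (- 8) * real N ^ 2 * X)"
  have B: "B \<ge> 0" using X by (simp add: B_def)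
  have inner: "ennreal B \<le> ennreal K * (\<integral>\<^sup>+t\<in>{0<..<2 * pi}. ennreal ((cmod (deriv \<Psi> (Complex s t)))\<^sup>2) \<partial>lborel)"
    if s: "s1 < s" "s < s2" for s
  proof -
    define r where "r = exp s"
    have r: "0 < r" "r < 1" using s s12 by (auto simp: r_def)
    have rc: "rcis r t = exp (Complex s t)" for t by (simp add: r_def rcis_def exp_eq_polar)
    have "exp (- 8) * real N ^ 2 * X = (\<Sum>n\<in>{N..<2 * N}. real N ^ 2 * (cmod (a n))\<^sup>2 * exp (- 8))"
      by (simp add: X_def sum_distrib_left mult_ac)
    also have "\<dots> \<le> (\<Sum>n\<in>{N..<2 * N}. (cmod (of_nat n * a n))\<^sup>2 * r ^ (2 * n))"
    proof (rule sum_mono)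
      fix n assume n: "n \<in> {N..<2 * N}"
      have "r ^ (2 * n) = exp (real (2 * n) * s)" unfolding r_def by (rule exp_of_nat_mult[symmetric])
      moreover have "- 8 \<le> real (2 * n) * s"
      proof -
        have "real (2 * n) * (- s) \<le> (4 * real N) * (2 / real N)"
          using n s s12 by (intro mult_mono) (auto simp: s1_def)
        also have "\<dots> = 8" using N by simp
        finally show ?thesis unfolding mult_minus_right by linarith
      qed
      ultimately have "exp (- 8) \<le> r ^ (2 * n)" by simp
      moreover have "real N ^ 2 * (cmod (a n))\<^sup>2 \<le> (cmod (of_nat n * a n))\<^sup>2"
        using n by (auto simp: norm_mult power_mult_distrib intro!: mult_right_mono power_mono)
      ultimately show "real N ^ 2 * (cmod (a n))\<^sup>2 * exp (- 8) \<le> (cmod (of_nat n * a n))\<^sup>2 * r ^ (2 * n)"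
        by (intro mult_mono) auto
    qed
    also have "\<dots> \<le> (\<Sum>n<2 * N. (cmod (of_nat n * a n))\<^sup>2 * r ^ (2 * n))"
      using r by (intro sum_mono2) auto
    finally have "B \<le> 2 * pi * (\<Sum>n<2 * N. (cmod (of_nat n * a n))\<^sup>2 * r ^ (2 * n))"
      unfolding B_def by (intro mult_left_mono) auto
    also have "\<dots> \<le> integral {0..2 * pi} (\<lambda>t. (cmod (g (rcis r t)))\<^sup>2)"
      using gs r by (rule coefficient_sum_le_circle_integral)
    finally have Bi: "B \<le> integral {0..2 * pi} (\<lambda>t. (cmod (g (rcis r t)))\<^sup>2)" .
    have "g holomorphic_on ball 0 1" using gs by (rule power_series_holomorphic_disc)
    then have "(\<lambda>t. (cmod (g (rcis r t)))\<^sup>2) integrable_on {0..2 * pi}"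
      by (intro integrable_continuous_interval continuous_intros continuous_on_circle
          holomorphic_on_imp_continuous_on r)
    then have "((\<lambda>t. (cmod (g (rcis r t)))\<^sup>2) has_integral integral {0..2 * pi} (\<lambda>t. (cmod (g (rcis r t)))\<^sup>2)) {0<..<2 * pi}"
      using integrable_integral by (simp add: has_integral_Icc_iff_Ioo[symmetric])
    from nn_integral_has_integral_lebesgue'[OF _ this]
    have "ennreal (integral {0..2 * pi} (\<lambda>t. (cmod (g (rcis r t)))\<^sup>2))
        = (\<integral>\<^sup>+t\<in>{0<..<2 * pi}. ennreal ((cmod (g (rcis r t)))\<^sup>2) \<partial>lborel)" by simp
    also have "\<dots> \<le> (\<integral>\<^sup>+t\<in>{0<..<2 * pi}. ennreal (K * (cmod (deriv \<Psi> (Complex s t)))\<^sup>2) \<partial>lborel)"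
      using gle s by (intro nn_integral_mono mult_right_mono ennreal_leI) (auto simp: rc)
    also have "\<dots> = (\<integral>\<^sup>+t. ennreal K * (ennreal ((cmod (deriv \<Psi> (Complex s t)))\<^sup>2) * indicator {0<..<2 * pi} t) \<partial>lborel)"
      using K by (simp add: ennreal_mult mult.assoc)
    also have "\<dots> = ennreal K * (\<integral>\<^sup>+t\<in>{0<..<2 * pi}. ennreal ((cmod (deriv \<Psi> (Complex s t)))\<^sup>2) \<partial>lborel)"
    proof (rule nn_integral_cmult)
      have "continuous_on {0<..<2 * pi} (\<lambda>t. deriv \<Psi> (Complex s t))"
        by (rule continuous_on_compose2[OF holomorphic_on_imp_continuous_on[OF holomorphic_deriv[OF hol\<Psi> U]]])
          (use s s12 in \<open>auto simp: U_def Complex_eq intro!: continuous_intros\<close>)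
      then have "(\<lambda>t. ennreal ((cmod (deriv \<Psi> (Complex s t)))\<^sup>2) * indicator {0<..<2 * pi} t) \<in> borel_measurable borel"
        by (intro borel_measurable_continuous_on_times_indicator continuous_on_ennreal continuous_intros) auto
      then show "(\<lambda>t. ennreal ((cmod (deriv \<Psi> (Complex s t)))\<^sup>2) * indicator {0<..<2 * pi} t) \<in> borel_measurable lborel"
        by simp
    qed
    finally show ?thesis using ennreal_leI[OF Bi] by (rule order_trans[rotated])
  qed
  define Y where "Y s = (\<integral>\<^sup>+t\<in>{0<..<2 * pi}. ennreal ((cmod (deriv \<Psi> (Complex s t)))\<^sup>2) \<partial>lborel)" for s
  have area: "(\<integral>\<^sup>+s\<in>{s1<..<s2}. Y s \<partial>lborel) \<le> ennreal (4 * M\<^sup>2)"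
    unfolding Y_def
  proof (rule nn_integral_deriv_rectangle_le[OF hol\<Psi> U])
    show "inj_on \<Psi> {z. s1 < Re z \<and> Re z < s2 \<and> 0 < Im z \<and> Im z < 2 * pi}"
    proof (rule inj_onI)
      fix x y assume x: "x \<in> {z. s1 < Re z \<and> Re z < s2 \<and> 0 < Im z \<and> Im z < 2 * pi}"
        and y: "y \<in> {z. s1 < Re z \<and> Re z < s2 \<and> 0 < Im z \<and> Im z < 2 * pi}" and eq: "\<Psi> x = \<Psi> y"
      have "x \<in> U" "y \<in> U" using x y s12 by (auto simp: U_def)
      then have "exp x = exp y"
        using inj_onD[OF inj eq[unfolded \<Psi>_def]] expU by blast
      from exp_complex_eqI[OF _ this] show "x = y" using x y by auto
    qed
    show "cmod (\<Psi> (Complex s t)) \<le> M" if "s < s2" for s t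
      unfolding \<Psi>_def using that by (intro M) (simp add: s2_def)
    show "Complex s t \<in> U" if "s < s2" for s t using that s12 by (simp add: U_def)
  qed fact
  have "B * (s2 - s1) \<le> K * (4 * M\<^sup>2)"
  \<comment> \<open>\<open>K\<close> vanishes when \<open>M = 0\<close> and \<open>m > 1\<close>. It
    cannot be divided out then, but the bound on a single circle already gives
    \<open>B = 0\<close>.\<close>
  proof (cases "K = 0")
    case True
    then have "ennreal B \<le> 0" using inner[of "(s1 + s2) / 2"] s12(3) by simp
    then show ?thesis using B True by simp
  next
    case False
    have "ennreal (B / K) \<le> Y s" if "s1 < s" "s < s2" for s
    proof -
      have "ennreal K * ennreal (B / K) \<le> ennreal K * Y s"
        using inner[OF that] B K False by (simp add: Y_def flip: ennreal_mult)
      then show ?thesis using K False by (subst (asm) ennreal_mult_le_mult_iff) auto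
    qed
    then have "(\<integral>\<^sup>+s\<in>{s1<..<s2}. ennreal (B / K) \<partial>lborel) \<le> (\<integral>\<^sup>+s\<in>{s1<..<s2}. Y s \<partial>lborel)"
      by (intro nn_integral_mono) (auto simp: indicator_def)
    also note area
    also have "(\<integral>\<^sup>+s\<in>{s1<..<s2}. ennreal (B / K) \<partial>lborel) = ennreal (B / K * (s2 - s1))"
      using B K s12(3) ennreal_mult[of "B / K" "s2 - s1"] by (simp add: nn_integral_cmult_indicator)
    finally have "B / K * (s2 - s1) \<le> 4 * M\<^sup>2" by (simp add: ennreal_le_iff)
    then show ?thesis using K False by (simp add: field_simps)
  qed
  also have "K * (4 * M\<^sup>2) = 4 * (real m ^ 2 * M ^ (2 * m))"
  proof -
    have "M ^ (2 * m) = M ^ (2 * (m - 1)) * M\<^sup>2"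
      using m by (cases m) (auto simp: power2_eq_square)
    then show ?thesis by (simp add: K_def)
  qed
  finally have "2 * pi * (exp (- 8) * real N * X) \<le> 4 * (real m ^ 2 * M ^ (2 * m))"
    using N by (simp add: B_def s12 power2_eq_square)
  \<comment> \<open>\<open>2 * pi \<ge> 4\<close> cancels the factor 4 from the area of the
    square.\<close>
  moreover have "4 * (exp (- 8) * real N * X) \<le> 2 * pi * (exp (- 8) * real N * X)"
    using pi_gt3 X by (intro mult_right_mono) auto
  ultimately have "exp (- 8) * real N * X \<le> real m ^ 2 * M ^ (2 * m)" by linarith
  then show ?thesis unfolding X_def[symmetric] using N by (simp add: exp_minus field_simps)
qed

text \<open>On the disc of radius \<open>exp (- 1 / N)\<close> the growth bound gives
  \<open>|\<psi>|^(2m) \<le> sqrt (2 C N)\<close>. The dyadic block at \<open>N\<close> is then of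
  order \<open>N / N^(3/2)\<close>, which is why the exponent is \<open>4 * m\<close>, twice what
  the block estimate contains.\<close>

lemma univalent_power_H2:
  assumes hol: "\<psi> holomorphic_on ball 0 1" and inj: "inj_on \<psi> (ball 0 1)"
    and f: "\<And>z. z \<in> ball 0 1 \<Longrightarrow> (\<lambda>n. a n * z ^ n) sums (\<psi> z ^ m)" and m: "m \<ge> 1"
    and C: "C \<ge> 0" "\<And>z. cmod z < 1 \<Longrightarrow> cmod (\<psi> z) ^ (4 * m) \<le> C / (1 - cmod z)"
  shows "\<exists>A. \<forall>N. (\<Sum>n<N. (cmod (a n))\<^sup>2) \<le> A"
proof (rule sum_dyadic_bound)
  fix N :: nat assume N: "N \<ge> 1"
  define M where "M = root (4 * m) (2 * C * real N)"
  have M: "M \<ge> 0" "M ^ (4 * m) = 2 * C * real N"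
    using m C(1) by (auto simp: M_def)
  have "cmod (\<psi> z) \<le> M" if z: "cmod z \<le> exp (- 1 / real N)" for z
  proof -
    define x where "x = 1 / real N"
    have x: "0 < x" "x \<le> 1" using N by (auto simp: x_def)
    \<comment> \<open>The disc of radius \<open>exp (- x)\<close> stays at distance at least
      \<open>x / 2\<close> from the unit circle when \<open>x \<le> 1\<close>.\<close>
    have "exp (- x) \<le> 1 / (1 + x)"
      using exp_ge_add_one_self[of x] x by (simp add: exp_minus inverse_eq_divide frac_le)
    also have "\<dots> \<le> 1 - x / 2"
      using x by (simp add: divide_simps algebra_simps mult_left_le_one_le power2_eq_square)
    finally have lez: "x / 2 \<le> 1 - cmod z" using z by (simp add: x_def)
    then have z1: "cmod z < 1" using x by linarith
    have "cmod (\<psi> z) ^ (4 * m) \<le> C / (1 - cmod z)" by (rule C(2)[OF z1])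
    also have "\<dots> \<le> C / (x / 2)" using lez x C(1) by (intro divide_left_mono) auto
    also have "\<dots> = M ^ (4 * m)" using N by (simp add: M(2) x_def)
    finally show ?thesis using M(1) m by (subst (asm) power_mono_iff) auto
  qed
  from univalent_power_dyadic_coefficients[OF hol inj f m N M(1) this]
  have "(\<Sum>n\<in>{N..<2 * N}. (cmod (a n))\<^sup>2) \<le> exp 8 * real m ^ 2 * M ^ (2 * m) / real N" .
  also have "M ^ (2 * m) = sqrt (2 * C * real N)"
    using M by (intro real_sqrt_unique[symmetric]) (simp_all flip: power_mult add: mult.commute mult.left_commute)
  also have "exp 8 * real m ^ 2 * sqrt (2 * C * real N) / real N
      = exp 8 * real m ^ 2 * sqrt (2 * C) * (sqrt (real N) / real N)"
    by (simp add: real_sqrt_mult)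
  also have "sqrt (real N) / real N = 1 / sqrt (real N)"
    using N real_div_sqrt[of "real N"] by (simp add: divide_simps)
  finally show "(\<Sum>n\<in>{N..<2 * N}. (cmod (a n))\<^sup>2) \<le> exp 8 * real m ^ 2 * sqrt (2 * C) / sqrt (real N)"
    by simp
qed auto

section \<open>Comparison of the two limits\<close>

text \<open>The zero function belongs to the lower Perron class.\<close>

lemma harmonic_measure_nonneg:
  assumes "open (D - E)"
  shows "0 \<le> harmonic_measure D z E"
proof -
  define S where "S = connected_component_set (D - E) z"
  have "open S" unfolding S_def using assms by (rule open_connected_component)
  moreover have "\<exists>\<rho>>0. ball w \<rho> \<subseteq> S \<and> (\<forall>r. 0 < r \<and> r < \<rho> \<longrightarrow> 0 \<le> circle_mean (\<lambda>_. 0) w r)" if "w \<in> S" for w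
    using openE[OF \<open>open S\<close> that] circle_mean_Re[of "\<lambda>_. 0"] by (metis holomorphic_on_const order_refl zero_complex.sel(1) zero_ereal_def)
  moreover have L: "Limsup (at \<zeta> within S) (\<lambda>_. 0 :: ereal) \<le> 0" for \<zeta>
    by (rule Limsup_bounded) simp
  ultimately have "subharmonic_on (\<lambda>_. 0) S" by (simp add: subharmonic_on_def)
  moreover have "Limsup (at \<zeta> within S) (\<lambda>_. 0 :: ereal) \<le> ereal (indicator E \<zeta>)" for \<zeta>
    using L by (rule order_trans) simp
  ultimately show ?thesis
    unfolding harmonic_measure_def perron_solution_def S_def[symmetric]
    by (intro SUP_upper2[of "\<lambda>_. 0"]) auto
qed

text \<open>For \<open>x = 0\<close> the right side is \<open>\<infinity>\<close>, which covers
  empty level sets.\<close>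

lemma ereal_log_inverse_ge:
  assumes "0 \<le> x" "x \<le> ereal y" "0 < y"
  shows "ereal (- ln y) \<le> ereal_log (inverse x)"
proof (cases x)
  case (real r)
  then show ?thesis using assms by (cases "r = 0") (auto simp: ereal_log_def ln_inverse)
qed (use assms in auto)

lemma ereal_log_inverse_le:
  assumes "ereal y \<le> x" "0 < y"
  shows "ereal_log (inverse x) \<le> ereal (- ln y)"
  using assms by (cases x) (auto simp: ereal_log_def ln_inverse)

lemma ereal_less_divide_iff:
  "0 < l \<Longrightarrow> ereal x < ereal y / ereal l \<longleftrightarrow> x * l < y"
  by (subst ereal_divide) (auto simp: pos_less_divide_eq simp del: ereal_divide)

lemma hyp_dist_0: "hyp_dist 0 z = ln ((1 + cmod z) / (1 - cmod z))"
  by (simp add: hyp_dist_def)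

lemma log_harmonic_measure_of_hyp_setdist:
  assumes hol: "\<psi> holomorphic_on ball 0 1" and inj: "inj_on \<psi> (ball 0 1)" and \<psi>0: "\<psi> 0 = 0"
    and lim: "((\<lambda>\<alpha>. hyp_setdist 0 (level_set \<psi> \<alpha>) / ereal (ln \<alpha>)) \<longlongrightarrow> \<infinity>) at_top"
  shows "((\<lambda>\<alpha>. ereal_log (inverse (harmonic_measure (ball 0 1) 0 (level_set \<psi> \<alpha>))) / ereal (ln \<alpha>)) \<longlongrightarrow> \<infinity>) at_top"
  unfolding tendsto_PInfty
proof
  fix c :: real
  \<comment> \<open>The bound \<open>\<omega> \<le> 4 A \<alpha>^(-2m)\<close> gives the ratio
    \<open>2 m - ln (4 A) / ln \<alpha>\<close>. One unit is reserved for the last term, which is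
    below 1 for large \<alpha>.\<close>
  obtain m :: nat where m: "m > 1 + \<bar>c\<bar>" using reals_Archimedean2 by blast
  then have m1: "m \<ge> 1" by linarith
  have "\<forall>\<^sub>F \<alpha> in at_top. ereal (real (4 * m)) < hyp_setdist 0 (level_set \<psi> \<alpha>) / ereal (ln \<alpha>)"
    using lim unfolding tendsto_PInfty by blast
  then obtain \<alpha>0 where \<alpha>0: "\<And>\<alpha>. \<alpha> \<ge> \<alpha>0 \<Longrightarrow> ereal (real (4 * m)) < hyp_setdist 0 (level_set \<psi> \<alpha>) / ereal (ln \<alpha>)"
    by (auto simp: eventually_at_top_linorder)
  define \<beta> where "\<beta> = max \<alpha>0 2"
  define C where "C = \<beta> ^ (4 * m) + 2"
  have C: "C \<ge> 0" by (simp add: C_def \<beta>_def)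
  \<comment> \<open>A point with \<open>|\<psi> z| = \<alpha> > \<beta>\<close> lies in its own
    level set, so its hyperbolic distance from 0 exceeds \<open>4 m ln \<alpha>\<close>. In
    \<open>C\<close>, the power of \<beta> handles small values and 2 bounds
    \<open>1 + |z|\<close>.\<close>
  have growth: "cmod (\<psi> z) ^ (4 * m) \<le> C / (1 - cmod z)" if z: "cmod z < 1" for z
  proof (cases "cmod (\<psi> z) \<le> \<beta>")
    case True
    have "cmod (\<psi> z) ^ (4 * m) \<le> \<beta> ^ (4 * m)" using True by (intro power_mono) auto
    also have "\<dots> \<le> C" by (simp add: C_def)
    also have "C = C / 1" by simp
    also have "\<dots> \<le> C / (1 - cmod z)" using z C by (intro divide_left_mono) auto
    finally show ?thesis .
  next
    case False
    define \<alpha> where "\<alpha> = cmod (\<psi> z)"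
    have \<alpha>: "\<alpha> \<ge> \<alpha>0" "\<alpha> > 2" using False by (auto simp: \<alpha>_def \<beta>_def)
    then have ln: "ln \<alpha> > 0" by simp
    have "z \<in> level_set \<psi> \<alpha>" using z by (simp add: level_set_def \<alpha>_def)
    then have "hyp_setdist 0 (level_set \<psi> \<alpha>) \<le> ereal (hyp_dist 0 z)"
      unfolding hyp_setdist_def by (rule INF_lower)
    then have "hyp_setdist 0 (level_set \<psi> \<alpha>) / ereal (ln \<alpha>) \<le> ereal (hyp_dist 0 z) / ereal (ln \<alpha>)"
      using ln by (intro ereal_divide_right_mono) auto
    with \<alpha>0[OF \<alpha>(1)] have "ereal (real (4 * m)) < ereal (hyp_dist 0 z) / ereal (ln \<alpha>)" by (rule less_le_trans)
    then have "real (4 * m) * ln \<alpha> < hyp_dist 0 z" using ln by (simp add: pos_less_divide_eq)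
    then have "ln (\<alpha> ^ (4 * m)) < ln ((1 + cmod z) / (1 - cmod z))"
      using \<alpha> by (simp add: hyp_dist_0 ln_realpow)
    then have "\<alpha> ^ (4 * m) \<le> (1 + cmod z) / (1 - cmod z)"
      using \<alpha> z by (subst (asm) ln_less_cancel_iff) (auto intro!: divide_pos_pos add_pos_nonneg)
    also have "\<dots> \<le> C / (1 - cmod z)"
    proof (rule divide_right_mono)
      have "0 \<le> \<beta> ^ (4 * m)" by (simp add: \<beta>_def)
      then show "1 + cmod z \<le> C" using z unfolding C_def by linarith
    qed (use z in auto)
    finally show ?thesis by (simp add: \<alpha>_def)
  qed
  define a where "a n = (deriv ^^ n) (\<lambda>z. \<psi> z ^ m) 0 / fact n" for n
  have hm: "(\<lambda>z. \<psi> z ^ m) holomorphic_on ball 0 1" by (intro holomorphic_intros hol)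
  have a: "(\<lambda>n. a n * z ^ n) sums (\<psi> z ^ m)" if "z \<in> ball 0 1" for z
    using holomorphic_power_series[OF hm that] by (simp add: a_def)
  obtain A0 where A0: "\<And>N. (\<Sum>n<N. (cmod (a n))\<^sup>2) \<le> A0"
    using univalent_power_H2[OF hol inj a m1 C growth] by blast
  define A where "A = max A0 1"
  have A: "A > 0" "\<And>N. (\<Sum>n<N. (cmod (a n))\<^sup>2) \<le> A"
    unfolding A_def using A0 by (auto intro: order_trans max.coboundedI1)
  have "\<forall>\<^sub>F \<alpha> in at_top. ln \<alpha> > max 0 (ln (4 * A))"
    using ln_at_top by (simp only: filterlim_at_top_dense)
  moreover have "\<forall>\<^sub>F \<alpha> in at_top. \<alpha> > (0::real)" by (rule eventually_gt_at_top)
  ultimately show "\<forall>\<^sub>F \<alpha> in at_top. ereal c < ereal_log (inverse (harmonic_measure (ball 0 1) 0 (level_set \<psi> \<alpha>))) / ereal (ln \<alpha>)"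
  proof eventually_elim
    case (elim \<alpha>)
    define \<omega> where "\<omega> = harmonic_measure (ball 0 1) 0 (level_set \<psi> \<alpha>)"
    have o: "open (ball 0 1 - level_set \<psi> \<alpha>)" using hol by (rule open_disc_minus_level_set)
    have "\<omega> \<le> ereal (4 * A / (\<alpha> ^ m)\<^sup>2)"
      unfolding \<omega>_def
    proof (rule harmonic_measure_le_H2[OF _ o _ a A(2)])
      show "\<alpha> ^ m \<le> norm (\<psi> z ^ m)" if "z \<in> level_set \<psi> \<alpha>" for z
        using that by (simp add: level_set_def norm_power)
    qed (use elim \<psi>0 in \<open>auto simp: level_set_def\<close>)
    moreover have "0 \<le> \<omega>" unfolding \<omega>_def using o by (rule harmonic_measure_nonneg)
    moreover have "0 < 4 * A / (\<alpha> ^ m)\<^sup>2" using A(1) elim by simp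
    ultimately have "ereal (- ln (4 * A / (\<alpha> ^ m)\<^sup>2)) \<le> ereal_log (inverse \<omega>)"
      by (intro ereal_log_inverse_ge)
    then have "ereal (- ln (4 * A / (\<alpha> ^ m)\<^sup>2)) / ereal (ln \<alpha>) \<le> ereal_log (inverse \<omega>) / ereal (ln \<alpha>)"
      using elim by (intro ereal_divide_right_mono) auto
    moreover have "ereal c < ereal (- ln (4 * A / (\<alpha> ^ m)\<^sup>2)) / ereal (ln \<alpha>)"
    proof -
      have "ln (4 * A / (\<alpha> ^ m)\<^sup>2) = ln (4 * A) - 2 * real m * ln \<alpha>"
        using A(1) elim by (simp add: ln_div ln_realpow flip: power_mult)
      moreover have "(1 + c) * ln \<alpha> \<le> (2 * real m) * ln \<alpha>"
        using m elim by (intro mult_right_mono) auto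
      ultimately have "c * ln \<alpha> < - ln (4 * A / (\<alpha> ^ m)\<^sup>2)"
        using elim by (simp add: distrib_right)
      then show ?thesis using elim by (subst ereal_less_divide_iff) auto
    qed
    ultimately show ?case unfolding \<omega>_def by (rule less_le_trans[rotated])
  qed
qed

text \<open>Each point of the level set bounds the harmonic measure from below, so a small measure
  pushes every point, and hence the infimum, away from 0.\<close>

lemma hyp_setdist_of_log_harmonic_measure:
  assumes hol: "\<psi> holomorphic_on ball 0 1" and inj: "inj_on \<psi> (ball 0 1)" and \<psi>0: "\<psi> 0 = 0"
    and lim: "((\<lambda>\<alpha>. ereal_log (inverse (harmonic_measure (ball 0 1) 0 (level_set \<psi> \<alpha>))) / ereal (ln \<alpha>)) \<longlongrightarrow> \<infinity>) at_top"
  shows "((\<lambda>\<alpha>. hyp_setdist 0 (level_set \<psi> \<alpha>) / ereal (ln \<alpha>)) \<longlongrightarrow> \<infinity>) at_top"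
  unfolding tendsto_PInfty
proof
  fix c :: real
  \<comment> \<open>\<open>r = 3 (|c| + 1) + 1\<close>: the 3 comes from the cube in the lower
    bound, and the last unit absorbs \<open>C < ln \<alpha>\<close>.\<close>
  define r where "r = 3 * \<bar>c\<bar> + 4"
  define C where "C = ln (36864 :: real)"
  have "compact (\<psi> ` cball 0 (1/2))"
    by (intro compact_continuous_image holomorphic_on_imp_continuous_on holomorphic_on_subset[OF hol]) auto
  then obtain B where B: "\<And>z. z \<in> cball 0 (1/2) \<Longrightarrow> cmod (\<psi> z) \<le> B"
    using compact_imp_bounded by (force simp: bounded_iff)
  have "\<forall>\<^sub>F \<alpha> in at_top. ereal r < ereal_log (inverse (harmonic_measure (ball 0 1) 0 (level_set \<psi> \<alpha>))) / ereal (ln \<alpha>)"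
    using lim unfolding tendsto_PInfty by blast
  moreover have "\<forall>\<^sub>F \<alpha> in at_top. ln \<alpha> > max 0 C"
    using ln_at_top by (simp only: filterlim_at_top_dense)
  moreover have "\<forall>\<^sub>F \<alpha> in at_top. \<alpha> > B" by (rule eventually_gt_at_top)
  ultimately show "\<forall>\<^sub>F \<alpha> in at_top. ereal c < hyp_setdist 0 (level_set \<psi> \<alpha>) / ereal (ln \<alpha>)"
  proof eventually_elim
    case (elim \<alpha>)
    have ln: "ln \<alpha> > 0" "ln \<alpha> > C" using elim by auto
    \<comment> \<open>The infimum preserves only weak inequalities; \<open>|c| + 1\<close> in place
      of \<open>c\<close> restores strictness. An empty level set is covered vacuously.\<close>
    have "ereal ((\<bar>c\<bar> + 1) * ln \<alpha>) \<le> hyp_setdist 0 (level_set \<psi> \<alpha>)"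
      unfolding hyp_setdist_def
    proof (rule INF_greatest)
      fix z assume z: "z \<in> level_set \<psi> \<alpha>"
      have z1: "cmod z < 1" using z by (simp add: level_set_def)
      have "ereal ((1 - cmod z) ^ 3 / 36864) \<le> harmonic_measure (ball 0 1) 0 (level_set \<psi> \<alpha>)"
        using hol inj \<psi>0
      proof (rule harmonic_measure_level_set_ge[OF _ _ _ _ z])
        show "cmod (\<psi> w) < \<alpha>" if "cmod w < 1 / 2" for w using B[of w] that elim(3) by simp
      qed
      then have "ereal_log (inverse (harmonic_measure (ball 0 1) 0 (level_set \<psi> \<alpha>))) \<le> ereal (- ln ((1 - cmod z) ^ 3 / 36864))"
        using z1 by (intro ereal_log_inverse_le) auto
      then have "ereal_log (inverse (harmonic_measure (ball 0 1) 0 (level_set \<psi> \<alpha>))) / ereal (ln \<alpha>)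
          \<le> ereal (- ln ((1 - cmod z) ^ 3 / 36864)) / ereal (ln \<alpha>)"
        using ln by (intro ereal_divide_right_mono) auto
      with elim(1) have "ereal r < ereal (- ln ((1 - cmod z) ^ 3 / 36864)) / ereal (ln \<alpha>)" by (rule less_le_trans)
      then have "r * ln \<alpha> < - ln ((1 - cmod z) ^ 3 / 36864)" using ln by (subst (asm) ereal_less_divide_iff) auto
      also have "\<dots> = C - 3 * ln (1 - cmod z)" using z1 by (simp add: ln_div ln_realpow C_def)
      finally have "r * ln \<alpha> < C - 3 * ln (1 - cmod z)" .
      moreover have "hyp_dist 0 z = ln (1 + cmod z) - ln (1 - cmod z)"
        using z1 add_pos_nonneg[of 1 "cmod z"] by (simp add: hyp_dist_0 ln_div)
      moreover have "0 \<le> ln (1 + cmod z)" by simp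
      moreover have "r * ln \<alpha> = 3 * ((\<bar>c\<bar> + 1) * ln \<alpha>) + ln \<alpha>" by (simp add: r_def algebra_simps)
      ultimately show "ereal ((\<bar>c\<bar> + 1) * ln \<alpha>) \<le> ereal (hyp_dist 0 z)" using ln unfolding ereal_less_eq by linarith
    qed
    then have "ereal ((\<bar>c\<bar> + 1) * ln \<alpha>) / ereal (ln \<alpha>) \<le> hyp_setdist 0 (level_set \<psi> \<alpha>) / ereal (ln \<alpha>)"
      using ln by (intro ereal_divide_right_mono) auto
    moreover have "ereal c < ereal ((\<bar>c\<bar> + 1) * ln \<alpha>) / ereal (ln \<alpha>)" using ln by simp
    ultimately show ?case by (rule less_le_trans[rotated])
  qed
qed

theorem corollary1p1:
  fixes \<psi> :: "complex \<Rightarrow> complex"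
  assumes "\<psi> holomorphic_on ball 0 1" and "inj_on \<psi> (ball 0 1)" and "\<psi> 0 = 0"
  shows "((\<lambda>\<alpha>::real. hyp_setdist 0 (level_set \<psi> \<alpha>) / ereal (ln \<alpha>)) \<longlongrightarrow> \<infinity>) at_top \<longleftrightarrow>
         ((\<lambda>\<alpha>::real. ereal_log (inverse (harmonic_measure (ball 0 1) 0 (level_set \<psi> \<alpha>)))
                        / ereal (ln \<alpha>)) \<longlongrightarrow> \<infinity>) at_top"
  using log_harmonic_measure_of_hyp_setdist[OF assms] hyp_setdist_of_log_harmonic_measure[OF assms]
  by blast

end
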